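(* Let $G$ be a finite group and let $k$ be an infinite field for which Hilbert's irreducibility theorem is valid (e.g. $k$ is an algebraic number field). If $k(G)$ is retract $k$-rational, then there is a Galois extension field $K$ of $k$ whose Galois group is isomorphic to $G$.
   Context: For a finite group $G$ and a field $k$, let $G$ act on the rational function field $k(x_g : g\in G)$ (in $|G|$ variables) by $k$-automorphisms via $h\cdot x_g = x_{hg}$ for $g,h\in G$, and define $k(G)=k(x_g:g\in G)^G$, the fixed field. Let $k$ be an infinite field and $K/k$ a field extension. $K$ is called retract $k$-rational if there is a $k$-algebra $A\subset K$ such that (i) $K$ is the quotient field of $A$; (ii) there exist a non-zero polynomial $f\in k[X_1,\ldots,X_n]$ (a polynomial ring) and $k$-algebra morphisms $\varphi: A\to k[X_1,\ldots,X_n][1/f]$ and $\psi: k[X_1,\ldots,X_n][1/f]\to A$ with $\psi\circ\varphi=1_A$. "Hilbert's irreducibility theorem is valid for $k$" means that $k$ is a Hilbertian field: for every $n\ge 1$, every irreducible polynomial $h\in k(X_1,\ldots,X_n)[T]$ that is separable in $T$, and every non-zero $f\in k[X_1,\ldots,X_n]$, there is $a\in k^n$ with $f(a)\neq 0$ such that the coefficients of $h$ are defined at $a$ and the specialized polynomial $h(a,T)\in k[T]$ is irreducible over $k$. *)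

theory Defs
  imports
    "HOL-Algebra.Algebraic_Closure_Type"
    "HOL-Algebra.Bij"
    "HOL-Library.Poly_Mapping"
begin

section \<open>Multivariate polynomials over an arbitrary set of variables\<close>

text \<open>
  The convolution algebra of \<^theory>\<open>HOL-Library.Poly_Mapping\<close> is an instance of \<^class>\<open>idom\<close>
  only when the variables are linearly ordered, which is not available for variables
  indexed by the elements of a group. The type below is a copy without that restriction.
\<close>

typedef (overloaded) ('x, 'a) mpoly = "UNIV :: (('x \<Rightarrow>\<^sub>0 nat) \<Rightarrow>\<^sub>0 'a::zero) set"
  morphisms mapping_of MPoly ..

setup_lifting type_definition_mpoly

instantiation mpoly :: (type, comm_ring_1) comm_ring_1
begin

lift_definition zero_mpoly :: "('a, 'b) mpoly" is 0 .
lift_definition one_mpoly :: "('a, 'b) mpoly" is 1 .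
lift_definition plus_mpoly :: "('a, 'b) mpoly \<Rightarrow> ('a, 'b) mpoly \<Rightarrow> ('a, 'b) mpoly" is "(+)" .
lift_definition minus_mpoly :: "('a, 'b) mpoly \<Rightarrow> ('a, 'b) mpoly \<Rightarrow> ('a, 'b) mpoly" is "(-)" .
lift_definition uminus_mpoly :: "('a, 'b) mpoly \<Rightarrow> ('a, 'b) mpoly" is uminus .
lift_definition times_mpoly :: "('a, 'b) mpoly \<Rightarrow> ('a, 'b) mpoly \<Rightarrow> ('a, 'b) mpoly" is "(*)" .

instance
  by standard (transfer; simp add: algebra_simps)+

end

subsection \<open>Evaluation of poly-mappings along a monomial map\<close>

definition pm_eval :: "('a::zero \<Rightarrow> 'r::comm_ring_1) \<Rightarrow> ('m \<Rightarrow> 'r) \<Rightarrow> ('m \<Rightarrow>\<^sub>0 'a) \<Rightarrow> 'r" where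
  "pm_eval c \<mu> p = (\<Sum>m\<in>Poly_Mapping.keys p. c (Poly_Mapping.lookup p m) * \<mu> m)"

locale unital_ring_hom =
  fixes c :: "'a::comm_ring_1 \<Rightarrow> 'b::comm_ring_1"
  assumes hom_add: "c (x + y) = c x + c y"
    and hom_mult: "c (x * y) = c x * c y"
    and hom_1: "c 1 = 1"
begin

lemma hom_0: "c 0 = 0"
  using hom_add[of 0 0] by simp

end

lemma pm_eval_superset:
  assumes "finite S" "Poly_Mapping.keys p \<subseteq> S" "c 0 = 0"
  shows "pm_eval c \<mu> p = (\<Sum>m\<in>S. c (Poly_Mapping.lookup p m) * \<mu> m)"
  unfolding pm_eval_def
  by (rule sum.mono_neutral_left) (use assms in \<open>auto simp: in_keys_iff\<close>)

lemma pm_eval_0 [simp]: "pm_eval c \<mu> 0 = 0"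
  by (simp add: pm_eval_def)

lemma pm_eval_single: "c 0 = 0 \<Longrightarrow> pm_eval c \<mu> (Poly_Mapping.single m a) = c a * \<mu> m"
  by (simp add: pm_eval_def)

lemma pm_eval_add:
  assumes "unital_ring_hom c"
  shows "pm_eval c \<mu> (p + q) = pm_eval c \<mu> p + pm_eval c \<mu> q"
proof -
  interpret unital_ring_hom c by fact
  let ?S = "Poly_Mapping.keys p \<union> Poly_Mapping.keys q"
  have "Poly_Mapping.keys (p + q) \<subseteq> ?S" by (rule keys_add)
  then show ?thesis
    by (simp add: pm_eval_superset[of ?S] hom_0 lookup_add hom_add sum.distrib distrib_right)
qed

lemma pm_eval_sum:
  assumes "unital_ring_hom c"
  shows "pm_eval c \<mu> (\<Sum>i\<in>I. f i) = (\<Sum>i\<in>I. pm_eval c \<mu> (f i))"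
  by (induction I rule: infinite_finite_induct) (auto simp: pm_eval_add[OF assms])

lemma pm_sum_single:
  "p = (\<Sum>m\<in>Poly_Mapping.keys p. Poly_Mapping.single m (Poly_Mapping.lookup p m))"
proof (rule poly_mapping_eqI)
  fix k
  have "Poly_Mapping.lookup (\<Sum>m\<in>Poly_Mapping.keys p. Poly_Mapping.single m (Poly_Mapping.lookup p m)) k
      = (\<Sum>m\<in>Poly_Mapping.keys p. if m = k then Poly_Mapping.lookup p m else 0)"
    by (auto simp: lookup_sum lookup_single when_def intro!: sum.cong)
  also have "\<dots> = Poly_Mapping.lookup p k"
    by (simp add: in_keys_iff)
  finally show "Poly_Mapping.lookup p k
      = Poly_Mapping.lookup (\<Sum>m\<in>Poly_Mapping.keys p. Poly_Mapping.single m (Poly_Mapping.lookup p m)) k"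
    by simp
qed

lemma pm_eval_mult:
  fixes \<mu> :: "'m::comm_monoid_add \<Rightarrow> 'r::comm_ring_1"
  assumes "unital_ring_hom c" and \<mu>: "\<And>m m'. \<mu> (m + m') = \<mu> m * \<mu> m'"
  shows "pm_eval c \<mu> (p * q) = pm_eval c \<mu> p * pm_eval c \<mu> q"
proof -
  interpret unital_ring_hom c by fact
  let ?l = "Poly_Mapping.lookup" and ?K = "Poly_Mapping.keys" and ?s = "Poly_Mapping.single"
  have "p * q = (\<Sum>m\<in>?K p. \<Sum>m'\<in>?K q. ?s (m + m') (?l p m * ?l q m'))"
    by (subst (1) pm_sum_single[of p], subst (1) pm_sum_single[of q])
      (simp add: sum_product mult_single)
  then have "pm_eval c \<mu> (p * q) =
      (\<Sum>m\<in>?K p. \<Sum>m'\<in>?K q. c (?l p m) * \<mu> m * (c (?l q m') * \<mu> m'))"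
    by (simp add: pm_eval_sum assms(1) pm_eval_single hom_0 hom_mult \<mu> mult_ac)
  also have "\<dots> = pm_eval c \<mu> p * pm_eval c \<mu> q"
    by (simp add: pm_eval_def sum_product)
  finally show ?thesis .
qed

subsection \<open>Absence of zero divisors\<close>

definition pm_rename :: "('x \<Rightarrow> nat) \<Rightarrow> ('x \<Rightarrow>\<^sub>0 nat) \<Rightarrow> (nat \<Rightarrow>\<^sub>0 nat)" where
  "pm_rename f m = (\<Sum>x\<in>Poly_Mapping.keys m. Poly_Mapping.single (f x) (Poly_Mapping.lookup m x))"

lemma pm_rename_add: "pm_rename f (m + m') = pm_rename f m + pm_rename f m'"
proof -
  let ?S = "Poly_Mapping.keys m \<union> Poly_Mapping.keys m'"
  have *: "pm_rename f n = (\<Sum>x\<in>?S. Poly_Mapping.single (f x) (Poly_Mapping.lookup n x))"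
    if "Poly_Mapping.keys n \<subseteq> ?S" for n
    unfolding pm_rename_def
    by (rule sum.mono_neutral_left) (use that in \<open>auto simp: in_keys_iff\<close>)
  show ?thesis
    by (simp add: * keys_add lookup_add single_add sum.distrib)
qed

lemma pm_rename_lookup:
  assumes "inj_on f V" "Poly_Mapping.keys m \<subseteq> V" "x \<in> V"
  shows "Poly_Mapping.lookup (pm_rename f m) (f x) = Poly_Mapping.lookup m x"
proof -
  have "Poly_Mapping.lookup (pm_rename f m) (f x)
      = (\<Sum>y\<in>Poly_Mapping.keys m. if y = x then Poly_Mapping.lookup m y else 0)"
    unfolding pm_rename_def lookup_sum
    by (rule sum.cong) (use assms in \<open>auto simp: lookup_single when_def dest: inj_onD\<close>)
  also have "\<dots> = Poly_Mapping.lookup m x"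
    by (simp add: in_keys_iff)
  finally show ?thesis .
qed

lemma pm_rename_inj:
  assumes "inj_on f V" "Poly_Mapping.keys m \<subseteq> V" "Poly_Mapping.keys m' \<subseteq> V"
    and "pm_rename f m = pm_rename f m'"
  shows "m = m'"
proof (rule poly_mapping_eqI)
  fix x
  show "Poly_Mapping.lookup m x = Poly_Mapping.lookup m' x"
  proof (cases "x \<in> V")
    case True
    then show ?thesis using pm_rename_lookup[OF assms(1)] assms by metis
  next
    case False
    then have "x \<notin> Poly_Mapping.keys m" "x \<notin> Poly_Mapping.keys m'" using assms by auto
    then show ?thesis by (simp add: in_keys_iff)
  qed
qed

lemma pm_no_zero_divisors:
  fixes p q :: "('x \<Rightarrow>\<^sub>0 nat) \<Rightarrow>\<^sub>0 'a::idom"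
  assumes "p * q = 0"
  shows "p = 0 \<or> q = 0"
proof -
  define V where "V = (\<Union>m\<in>Poly_Mapping.keys p \<union> Poly_Mapping.keys q. Poly_Mapping.keys m)"
  have "finite V" by (simp add: V_def)
  then obtain f :: "'x \<Rightarrow> nat" where f: "inj_on f V"
    using finite_imp_inj_to_nat_seg by metis
  define c where "c = (\<lambda>a::'a. Poly_Mapping.single (0::nat \<Rightarrow>\<^sub>0 nat) a)"
  define \<mu> where "\<mu> = (\<lambda>m. Poly_Mapping.single (pm_rename f m) (1::'a))"
  have c: "unital_ring_hom c"
    by standard (simp_all add: c_def single_add mult_single)
  have \<mu>: "\<mu> (m + m') = \<mu> m * \<mu> m'" for m m'
    by (simp add: \<mu>_def pm_rename_add mult_single)
  have inj: "r = 0" if r: "pm_eval c \<mu> r = 0"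
    and V: "\<And>m. m \<in> Poly_Mapping.keys r \<Longrightarrow> Poly_Mapping.keys m \<subseteq> V" for r
  proof (rule ccontr)
    assume "r \<noteq> 0"
    then obtain m where m: "m \<in> Poly_Mapping.keys r"
      by (metis all_not_in_conv poly_mapping_eqI lookup_zero in_keys_iff)
    have "Poly_Mapping.lookup (pm_eval c \<mu> r) (pm_rename f m)
      = (\<Sum>m'\<in>Poly_Mapping.keys r. if m' = m then Poly_Mapping.lookup r m' else 0)"
      unfolding pm_eval_def lookup_sum c_def \<mu>_def mult_single
      by (rule sum.cong)
        (use m V pm_rename_inj[OF f] in \<open>auto simp: lookup_single when_def\<close>)
    also have "\<dots> = Poly_Mapping.lookup r m" using m by simp
    finally show False using r m by (simp add: in_keys_iff)
  qed
  have "pm_eval c \<mu> p * pm_eval c \<mu> q = 0"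
    using pm_eval_mult[OF c \<mu>, where p=p and q=q] assms by simp
  then have "pm_eval c \<mu> p = 0 \<or> pm_eval c \<mu> q = 0" by simp
  then show ?thesis
    using inj by (auto simp: V_def)
qed

instance mpoly :: (type, idom) idom
proof
  fix p q :: "('a, 'b) mpoly"
  assume "p \<noteq> 0" "q \<noteq> 0"
  then show "p * q \<noteq> 0"
    by transfer (use pm_no_zero_divisors in blast)
qed

subsection \<open>Constants, variables and evaluation\<close>

definition mpoly_Const :: "'a \<Rightarrow> ('x, 'a::comm_ring_1) mpoly" where
  "mpoly_Const a = MPoly (Poly_Mapping.single 0 a)"

definition mpoly_Var :: "'x \<Rightarrow> ('x, 'a::comm_ring_1) mpoly" where
  "mpoly_Var x = MPoly (Poly_Mapping.single (Poly_Mapping.single x 1) 1)"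

definition mpoly_vars :: "('x, 'a::comm_ring_1) mpoly \<Rightarrow> 'x set" where
  "mpoly_vars p = (\<Union>m\<in>Poly_Mapping.keys (mapping_of p). Poly_Mapping.keys m)"

text \<open>The polynomial ring \<open>k[X\<^sub>v : v \<in> V]\<close> inside the polynomial ring in all variables of type \<open>'x\<close>.\<close>

definition poly_ring_in :: "'x set \<Rightarrow> ('x, 'a::comm_ring_1) mpoly set" where
  "poly_ring_in V = {p. mpoly_vars p \<subseteq> V}"

definition mpoly_eval ::
  "('a::comm_ring_1 \<Rightarrow> 'r::comm_ring_1) \<Rightarrow> ('x \<Rightarrow> 'r) \<Rightarrow> ('x, 'a) mpoly \<Rightarrow> 'r" where
  "mpoly_eval c s p =
     (\<Sum>m\<in>Poly_Mapping.keys (mapping_of p).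
        c (Poly_Mapping.lookup (mapping_of p) m)
          * (\<Prod>x\<in>Poly_Mapping.keys m. s x ^ Poly_Mapping.lookup m x))"

lemma mpoly_eval_pm:
  "mpoly_eval c s p =
     pm_eval c (\<lambda>m. \<Prod>x\<in>Poly_Mapping.keys m. s x ^ Poly_Mapping.lookup m x) (mapping_of p)"
  by (simp add: mpoly_eval_def pm_eval_def)

lemma monomial_eval_add:
  fixes s :: "'x \<Rightarrow> 'r::comm_ring_1"
  shows "(\<Prod>x\<in>Poly_Mapping.keys (m + m'). s x ^ Poly_Mapping.lookup (m + m') x)
     = (\<Prod>x\<in>Poly_Mapping.keys m. s x ^ Poly_Mapping.lookup m x)
       * (\<Prod>x\<in>Poly_Mapping.keys m'. s x ^ Poly_Mapping.lookup m' x)"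
proof -
  let ?S = "Poly_Mapping.keys m \<union> Poly_Mapping.keys m'"
  have *: "(\<Prod>x\<in>Poly_Mapping.keys n. s x ^ Poly_Mapping.lookup n x)
      = (\<Prod>x\<in>?S. s x ^ Poly_Mapping.lookup n x)"
    if "Poly_Mapping.keys n \<subseteq> ?S" for n
    by (rule prod.mono_neutral_left) (use that in \<open>auto simp: in_keys_iff\<close>)
  show ?thesis
    unfolding *[OF keys_add] *[OF Un_upper1] *[OF Un_upper2]
    by (simp add: lookup_add power_add prod.distrib)
qed

lemma mpoly_eval_add:
  "unital_ring_hom c \<Longrightarrow> mpoly_eval c s (p + q) = mpoly_eval c s p + mpoly_eval c s q"
  by (simp add: mpoly_eval_pm plus_mpoly.rep_eq pm_eval_add)

lemma mpoly_eval_mult: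
  "unital_ring_hom c \<Longrightarrow> mpoly_eval c s (p * q) = mpoly_eval c s p * mpoly_eval c s q"
  by (simp add: mpoly_eval_pm times_mpoly.rep_eq pm_eval_mult monomial_eval_add)

lemma mpoly_eval_Const: "c 0 = 0 \<Longrightarrow> mpoly_eval c s (mpoly_Const a) = c a"
  by (simp add: mpoly_eval_pm mpoly_Const_def MPoly_inverse pm_eval_single)

lemma mpoly_eval_Var: "unital_ring_hom c \<Longrightarrow> mpoly_eval c s (mpoly_Var x) = s x"
  by (simp add: mpoly_eval_pm mpoly_Var_def MPoly_inverse pm_eval_single
      unital_ring_hom.hom_0 unital_ring_hom.hom_1)

lemma mpoly_one_Const: "1 = mpoly_Const 1"
  by (simp add: mpoly_Const_def one_mpoly_def)

lemma mpoly_eval_1: "unital_ring_hom c \<Longrightarrow> mpoly_eval c s 1 = 1"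
  by (simp add: mpoly_one_Const mpoly_eval_Const unital_ring_hom.hom_0 unital_ring_hom.hom_1)

lemma mpoly_eval_hom: "unital_ring_hom c \<Longrightarrow> unital_ring_hom (mpoly_eval c s)"
  by standard (simp_all add: mpoly_eval_add mpoly_eval_mult mpoly_eval_1)

lemma unital_ring_hom_Const: "unital_ring_hom mpoly_Const"
proof
  fix x y :: 'a
  show "mpoly_Const (x + y) = (mpoly_Const x + mpoly_Const y :: ('x, 'a) mpoly)"
    unfolding mpoly_Const_def by (simp add: single_add plus_mpoly.abs_eq eq_onp_def)
  show "mpoly_Const (x * y) = (mpoly_Const x * mpoly_Const y :: ('x, 'a) mpoly)"
    unfolding mpoly_Const_def by (simp add: mult_single times_mpoly.abs_eq eq_onp_def)
qed (simp add: mpoly_one_Const)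

section \<open>Rational function fields\<close>

text \<open>The field \<open>k(X\<^sub>v : v \<in> V)\<close>, inside the fraction field of the full polynomial ring.\<close>

definition ratfun_in :: "'x set \<Rightarrow> ('x, 'k::field) mpoly fract set" where
  "ratfun_in V = {Fract p q | p q. p \<in> poly_ring_in V \<and> q \<in> poly_ring_in V \<and> q \<noteq> 0}"

definition ratfun_Const :: "'k::field \<Rightarrow> ('x, 'k) mpoly fract" where
  "ratfun_Const c = Fract (mpoly_Const c) 1"

definition ratfun_Var :: "'x \<Rightarrow> ('x, 'k::field) mpoly fract" where
  "ratfun_Var x = Fract (mpoly_Var x) 1"

lemma unital_ring_hom_ratfun_Const: "unital_ring_hom ratfun_Const"
  by standard
    (simp_all add: ratfun_Const_def unital_ring_hom.hom_add[OF unital_ring_hom_Const]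
      unital_ring_hom.hom_mult[OF unital_ring_hom_Const] mpoly_one_Const[symmetric] fract_collapse)

section \<open>The field \<open>k(G)\<close>\<close>

text \<open>
  \<open>ratfun_act G h\<close> is the \<open>k\<close>-automorphism of \<open>k(x\<^sub>g : g \<in> G)\<close> with \<open>x\<^sub>g \<mapsto> x\<^sub>h\<^sub>g\<close>: it sends
  \<open>p/q\<close> to the quotient of the substitution instances of \<open>p\<close> and \<open>q\<close>
  (see \<open>ratfun_act_Fract\<close> below for independence of the representation).
\<close>

definition ratfun_act ::
  "('g, 'b) monoid_scheme \<Rightarrow> 'g \<Rightarrow> ('g, 'k::field) mpoly fract \<Rightarrow> ('g, 'k) mpoly fract" where
  "ratfun_act G h u =
     (let \<sigma> = mpoly_eval ratfun_Const (\<lambda>g. ratfun_Var (h \<otimes>\<^bsub>G\<^esub> g))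
      in THE v. \<exists>p q. p \<in> poly_ring_in (carrier G) \<and> q \<in> poly_ring_in (carrier G) \<and> q \<noteq> 0
           \<and> u = Fract p q \<and> v = \<sigma> p / \<sigma> q)"

definition noether_field :: "('g, 'b) monoid_scheme \<Rightarrow> ('g, 'k::field) mpoly fract set" where
  "noether_field G = {u \<in> ratfun_in (carrier G). \<forall>h\<in>carrier G. ratfun_act G h u = u}"

lemma mpoly_sum_monomials:
  fixes p :: "('x, 'a::comm_ring_1) mpoly"
  shows "mpoly_eval mpoly_Const mpoly_Var p = p"
proof -
  have pw: "mpoly_Var x ^ n = (MPoly (Poly_Mapping.single (Poly_Mapping.single x n) 1) :: ('x, 'a) mpoly)"
    for x :: 'x and n
    by (induction n)
      (simp_all add: mpoly_Var_def one_mpoly_def times_mpoly.abs_eq eq_onp_def mult_single single_add[symmetric])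
  have pr: "(\<Prod>x\<in>S. mpoly_Var x ^ e x) =
      (MPoly (Poly_Mapping.single (\<Sum>x\<in>S. Poly_Mapping.single x (e x)) 1) :: ('x, 'a) mpoly)"
    if "finite S" for S :: "'x set" and e
    using that
    by (induction S)
      (simp_all add: pw one_mpoly_def times_mpoly.abs_eq eq_onp_def mult_single)
  have su: "(\<Sum>m\<in>S. MPoly (f m)) = (MPoly (\<Sum>m\<in>S. f m) :: ('x, 'a) mpoly)"
    if "finite S" for S :: "('x \<Rightarrow>\<^sub>0 nat) set" and f
    using that by (induction S) (simp_all add: zero_mpoly_def plus_mpoly.abs_eq eq_onp_def)
  show ?thesis
    unfolding mpoly_eval_def
    by (simp add: pr pm_sum_single[symmetric] mpoly_Const_def times_mpoly.abs_eq eq_onp_def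
        mult_single su mapping_of_inverse)
qed

lemma unital_ring_hom_sum: "unital_ring_hom c \<Longrightarrow> c (sum f A) = (\<Sum>a\<in>A. c (f a))"
  by (induction A rule: infinite_finite_induct)
    (auto simp: unital_ring_hom.hom_add unital_ring_hom.hom_0)

lemma unital_ring_hom_prod: "unital_ring_hom c \<Longrightarrow> c (prod f A) = (\<Prod>a\<in>A. c (f a))"
  by (induction A rule: infinite_finite_induct)
    (auto simp: unital_ring_hom.hom_mult unital_ring_hom.hom_1)

lemma unital_ring_hom_power: "unital_ring_hom c \<Longrightarrow> c (x ^ n) = c x ^ n"
  by (induction n) (auto simp: unital_ring_hom.hom_mult unital_ring_hom.hom_1)

lemma mpoly_eval_comp:
  assumes "unital_ring_hom f" "\<And>a. f (c a) = d a" "\<And>x. x \<in> mpoly_vars p \<Longrightarrow> f (s x) = t x"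
  shows "f (mpoly_eval c s p) = mpoly_eval d t p"
proof -
  have "(\<Prod>x\<in>Poly_Mapping.keys m. f (s x) ^ Poly_Mapping.lookup m x)
      = (\<Prod>x\<in>Poly_Mapping.keys m. t x ^ Poly_Mapping.lookup m x)"
    if "m \<in> Poly_Mapping.keys (mapping_of p)" for m
    by (rule prod.cong) (use that in \<open>auto simp: mpoly_vars_def intro!: assms(3) arg_cong[of _ _ "\<lambda>y. y ^ _"]\<close>)
  then show ?thesis
    unfolding mpoly_eval_def
    by (simp add: unital_ring_hom_sum[OF assms(1)] unital_ring_hom.hom_mult[OF assms(1)]
        unital_ring_hom_prod[OF assms(1)] unital_ring_hom_power[OF assms(1)] assms(2))
qed

lemma unital_ring_hom_Fract: "unital_ring_hom (\<lambda>p. Fract p 1)"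
  by standard (simp_all add: fract_collapse)

lemma ratfun_subst_inj:
  assumes "group G" "h \<in> carrier G" "p \<in> poly_ring_in (carrier G)"
    and z: "mpoly_eval ratfun_Const (\<lambda>g. ratfun_Var (h \<otimes>\<^bsub>G\<^esub> g)) p = 0"
  shows "p = (0 :: ('g, 'k::field) mpoly)"
proof -
  interpret group G by fact
  let ?q = "mpoly_eval mpoly_Const (\<lambda>g. mpoly_Var (h \<otimes>\<^bsub>G\<^esub> g)) p :: ('g, 'k) mpoly"
  let ?r = "mpoly_eval mpoly_Const (\<lambda>g. mpoly_Var (inv\<^bsub>G\<^esub> h \<otimes>\<^bsub>G\<^esub> g)) :: ('g, 'k) mpoly \<Rightarrow> _"
  have "Fract ?q 1 = mpoly_eval ratfun_Const (\<lambda>g. ratfun_Var (h \<otimes>\<^bsub>G\<^esub> g)) p"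
    by (rule mpoly_eval_comp[OF unital_ring_hom_Fract]) (simp_all add: ratfun_Const_def ratfun_Var_def)
  with z have "?q = 0" by (simp add: Zero_fract_def eq_fract)
  have "?r ?q = mpoly_eval mpoly_Const mpoly_Var p"
  proof (rule mpoly_eval_comp)
    show "unital_ring_hom ?r" by (rule mpoly_eval_hom[OF unital_ring_hom_Const])
    show "?r (mpoly_Const a) = mpoly_Const a" for a
      by (simp add: mpoly_eval_Const unital_ring_hom.hom_0[OF unital_ring_hom_Const])
    show "?r (mpoly_Var (h \<otimes>\<^bsub>G\<^esub> g)) = mpoly_Var g" if "g \<in> mpoly_vars p" for g
    proof -
      have "g \<in> carrier G" using that assms(3) by (auto simp: poly_ring_in_def)
      then show ?thesis
        using assms(2) by (simp add: mpoly_eval_Var[OF unital_ring_hom_Const] m_assoc[symmetric])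
    qed
  qed
  moreover have "?r 0 = 0"
    by (rule unital_ring_hom.hom_0[OF mpoly_eval_hom[OF unital_ring_hom_Const]])
  ultimately show ?thesis
    using \<open>?q = 0\<close> by (simp only: mpoly_sum_monomials)
qed

lemma ratfun_act_Fract:
  assumes "group G" "h \<in> carrier G"
    and "p \<in> poly_ring_in (carrier G)" "q \<in> poly_ring_in (carrier G)" "q \<noteq> 0"
  shows "ratfun_act G h (Fract p q) =
     mpoly_eval ratfun_Const (\<lambda>g. ratfun_Var (h \<otimes>\<^bsub>G\<^esub> g)) p
     / mpoly_eval ratfun_Const (\<lambda>g. ratfun_Var (h \<otimes>\<^bsub>G\<^esub> g)) (q :: ('g, 'k::field) mpoly)"
proof -
  define \<sigma> where "\<sigma> = (mpoly_eval ratfun_Const (\<lambda>g. ratfun_Var (h \<otimes>\<^bsub>G\<^esub> g))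
      :: ('g, 'k) mpoly \<Rightarrow> ('g, 'k) mpoly fract)"
  have nz: "\<sigma> r \<noteq> 0" if "r \<in> poly_ring_in (carrier G)" "r \<noteq> 0" for r
    using ratfun_subst_inj[OF assms(1,2)] that by (auto simp: \<sigma>_def)
  have mult: "\<sigma> (r * s) = \<sigma> r * \<sigma> s" for r s
    by (simp add: \<sigma>_def mpoly_eval_mult[OF unital_ring_hom_ratfun_Const])
  have "ratfun_act G h (Fract p q) =
     (THE v. \<exists>p' q'. p' \<in> poly_ring_in (carrier G) \<and> q' \<in> poly_ring_in (carrier G) \<and> q' \<noteq> 0
           \<and> Fract p q = Fract p' q' \<and> v = \<sigma> p' / \<sigma> q')"
    by (simp only: ratfun_act_def \<sigma>_def Let_def)
  also have "\<dots> = \<sigma> p / \<sigma> q"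
  proof (rule the_equality)
    show "\<exists>p' q'. p' \<in> poly_ring_in (carrier G) \<and> q' \<in> poly_ring_in (carrier G) \<and> q' \<noteq> 0
        \<and> Fract p q = Fract p' q' \<and> \<sigma> p / \<sigma> q = \<sigma> p' / \<sigma> q'"
      using assms by blast
  next
    fix v
    assume "\<exists>p' q'. p' \<in> poly_ring_in (carrier G) \<and> q' \<in> poly_ring_in (carrier G) \<and> q' \<noteq> 0
        \<and> Fract p q = Fract p' q' \<and> v = \<sigma> p' / \<sigma> q'"
    then obtain p' q' where *: "p' \<in> poly_ring_in (carrier G)" "q' \<in> poly_ring_in (carrier G)"
      "q' \<noteq> 0" "Fract p q = Fract p' q'" "v = \<sigma> p' / \<sigma> q'" by blast
    then have "p * q' = p' * q" using assms(5) by (simp add: eq_fract)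
    then have "\<sigma> p * \<sigma> q' = \<sigma> p' * \<sigma> q" by (metis mult)
    then show "v = \<sigma> p / \<sigma> q"
      using nz[of q] nz[of q'] assms * by (simp add: frac_eq_eq)
  qed
  finally show ?thesis by (simp add: \<sigma>_def)
qed

lemma ratfun_act_Var:
  assumes "group G" "h \<in> carrier G" "g \<in> carrier G"
  shows "ratfun_act G h (ratfun_Var g :: ('g, 'k::field) mpoly fract) = ratfun_Var (h \<otimes>\<^bsub>G\<^esub> g)"
proof -
  have "mpoly_Var g \<in> (poly_ring_in (carrier G) :: ('g, 'k) mpoly set)"
    using assms(3) by (simp add: poly_ring_in_def mpoly_vars_def mpoly_Var_def MPoly_inverse)
  moreover have "1 \<in> (poly_ring_in (carrier G) :: ('g, 'k) mpoly set)"
    by (simp add: poly_ring_in_def mpoly_vars_def one_mpoly.rep_eq)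
  ultimately show ?thesis
    using ratfun_act_Fract[OF assms(1,2), of "mpoly_Var g :: ('g, 'k) mpoly" 1]
    by (simp add: ratfun_Var_def[of g] mpoly_eval_Var[OF unital_ring_hom_ratfun_Const]
        mpoly_eval_1[OF unital_ring_hom_ratfun_Const])
qed

section \<open>Retract rationality\<close>

text \<open>The subset \<open>A\<close> of a type-class ring as a ring in the sense of \<^theory>\<open>HOL-Algebra.Ring\<close>.\<close>

abbreviation ring_on :: "'a::ring_1 set \<Rightarrow> 'a ring" where
  "ring_on A \<equiv> ring_of_type_algebra \<lparr> carrier := A \<rparr>"

text \<open>
  In the following, a \<open>k\<close>-algebra structure on a subset of a ring is given by the structure map
  \<open>\<iota> : k \<rightarrow> A\<close>.
\<close>

definition subalgebra :: "('k::field \<Rightarrow> 'l::comm_ring_1) \<Rightarrow> 'l set \<Rightarrow> bool" where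
  "subalgebra \<iota> A \<longleftrightarrow> subring A ring_of_type_algebra \<and> range \<iota> \<subseteq> A"

definition algebra_hom ::
  "('k::field \<Rightarrow> 'l::comm_ring_1) \<Rightarrow> 'l set \<Rightarrow> ('k \<Rightarrow> 'm::comm_ring_1) \<Rightarrow> 'm set \<Rightarrow> ('l \<Rightarrow> 'm) set" where
  "algebra_hom \<iota> A \<kappa> B = {\<phi> \<in> ring_hom (ring_on A) (ring_on B). \<forall>c. \<phi> (\<iota> c) = \<kappa> c}"

definition is_quotient_field_of :: "'l::field set \<Rightarrow> 'l set \<Rightarrow> bool" where
  "is_quotient_field_of L A \<longleftrightarrow> L = {a / b | a b. a \<in> A \<and> b \<in> A \<and> b \<noteq> 0}"

text \<open>The localised polynomial ring \<open>k[X\<^sub>v : v \<in> V][1/f]\<close>.\<close>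

definition localized_poly_ring :: "'x set \<Rightarrow> ('x, 'k::field) mpoly \<Rightarrow> ('x, 'k) mpoly fract set" where
  "localized_poly_ring V f = {Fract p (f ^ m) | p m. p \<in> poly_ring_in V}"

text \<open>
  \<open>L\<close> is the carrier of the extension field of \<open>k\<close>, with structure map \<open>\<iota>\<close>; the polynomial ring in
  \<open>n\<close> variables uses the variables \<open>X\<^sub>0, \<dots>, X\<^sub>n\<^sub>-\<^sub>1\<close>.
\<close>

definition retract_rational :: "('k::field \<Rightarrow> 'l::field) \<Rightarrow> 'l set \<Rightarrow> bool" where
  "retract_rational \<iota> L \<longleftrightarrow>
     (\<exists>A. subalgebra \<iota> A \<and> A \<subseteq> L \<and> is_quotient_field_of L A \<and>
        (\<exists>(n::nat) (f :: (nat, 'k) mpoly) \<phi> \<psi>.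
           f \<in> poly_ring_in {..<n} \<and> f \<noteq> 0 \<and>
           \<phi> \<in> algebra_hom \<iota> A ratfun_Const (localized_poly_ring {..<n} f) \<and>
           \<psi> \<in> algebra_hom ratfun_Const (localized_poly_ring {..<n} f) \<iota> A \<and>
           (\<forall>a\<in>A. \<psi> (\<phi> a) = a)))"

section \<open>Hilbertian fields\<close>

definition polys_over :: "'f::field set \<Rightarrow> 'f poly set" where
  "polys_over F = {p. \<forall>i. Polynomial.coeff p i \<in> F}"

text \<open>Irreducibility in \<open>F[T]\<close> for a subfield \<open>F\<close> of the ambient field.\<close>

definition irreducible_over :: "'f::field set \<Rightarrow> 'f poly \<Rightarrow> bool" where
  "irreducible_over F p \<longleftrightarrow> p \<in> polys_over F \<and> ring_irreducible\<^bsub>ring_on (polys_over F)\<^esub> p"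

lemma irreducible_over_UNIV: "irreducible_over UNIV p \<longleftrightarrow> Factorial_Ring.irreducible p"
proof -
  have R: "ring_on (polys_over UNIV) = (ring_of_type_algebra :: 'a poly ring)"
    by (simp add: polys_over_def ring_of_type_algebra_def)
  have U: "x \<in> Units (ring_of_type_algebra :: 'a poly ring) \<longleftrightarrow> x dvd 1" for x
    by (auto simp: Units_def ring_of_type_algebra_def dvd_def mult.commute)
  have D: "x divides\<^bsub>(ring_of_type_algebra :: 'a poly ring)\<^esub> y \<longleftrightarrow> x dvd y" for x y
    by (auto simp: factor_def ring_of_type_algebra_def dvd_def)
  have "irreducible_over UNIV p \<longleftrightarrow>
      p \<noteq> 0 \<and> \<not> p dvd 1 \<and> (\<forall>b. b dvd p \<and> \<not> p dvd b \<longrightarrow> b dvd 1)"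
    unfolding irreducible_over_def ring_irreducible_def R Divisibility.irreducible_def
      properfactor_def U D
    by (auto simp: polys_over_def ring_of_type_algebra_def)
  also have "\<dots> \<longleftrightarrow> Factorial_Ring.irreducible p"
    by (metis irreducible_altdef)
  finally show ?thesis .
qed

text \<open>Separable: no multiple roots in an algebraically closed extension field.\<close>

definition separable_poly :: "'f::field poly \<Rightarrow> bool" where
  "separable_poly p \<longleftrightarrow> rsquarefree (map_poly to_ac p)"

text \<open>
  All coefficients of \<open>h\<close> are defined at \<open>a\<close>, and \<open>h(a, T) = g\<close>. Points of \<open>k\<^sup>n\<close> are functions
  \<open>nat \<Rightarrow> 'k\<close>, of which only the values at arguments below \<open>n\<close> are used.
\<close>

definition specializes_to ::
  "nat \<Rightarrow> (nat \<Rightarrow> 'k::field) \<Rightarrow> (nat, 'k) mpoly fract poly \<Rightarrow> 'k poly \<Rightarrow> bool" where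
  "specializes_to n a h g \<longleftrightarrow>
     (\<forall>i. \<exists>p q. p \<in> poly_ring_in {..<n} \<and> q \<in> poly_ring_in {..<n} \<and>
        mpoly_eval (\<lambda>c. c) a q \<noteq> 0 \<and> Polynomial.coeff h i = Fract p q \<and>
        Polynomial.coeff g i = mpoly_eval (\<lambda>c. c) a p / mpoly_eval (\<lambda>c. c) a q)"

lemma specializes_to_unique:
  assumes "specializes_to n a h g" "specializes_to n a h g'"
  shows "g = g'"
proof (rule poly_eqI)
  fix i
  let ?e = "mpoly_eval (\<lambda>c. c) a"
  have hom: "unital_ring_hom (\<lambda>c::'a. c)" by standard simp_all
  obtain p q where 1: "?e q \<noteq> 0" "Polynomial.coeff h i = Fract p q" "Polynomial.coeff g i = ?e p / ?e q"
    using assms(1) unfolding specializes_to_def by blast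
  obtain p' q' where 2: "?e q' \<noteq> 0" "Polynomial.coeff h i = Fract p' q'" "Polynomial.coeff g' i = ?e p' / ?e q'"
    using assms(2) unfolding specializes_to_def by blast
  have "q \<noteq> 0" "q' \<noteq> 0"
    using 1(1) 2(1) unital_ring_hom.hom_0[OF mpoly_eval_hom[OF hom]] by metis+
  then have "p * q' = p' * q" using 1(2) 2(2) by (simp add: eq_fract)
  then have "?e p * ?e q' = ?e p' * ?e q" by (metis mpoly_eval_mult[OF hom])
  then show "Polynomial.coeff g i = Polynomial.coeff g' i"
    using 1 2 by (simp add: frac_eq_eq)
qed

definition hilbertian :: "'k::field itself \<Rightarrow> bool" where
  "hilbertian _ \<longleftrightarrow>
     (\<forall>n\<ge>1. \<forall>(h :: (nat, 'k) mpoly fract poly) (f :: (nat, 'k) mpoly).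
        irreducible_over (ratfun_in {..<n}) h \<and> separable_poly h \<and>
        f \<in> poly_ring_in {..<n} \<and> f \<noteq> 0 \<longrightarrow>
        (\<exists>a g. mpoly_eval (\<lambda>c. c) a f \<noteq> 0 \<and> specializes_to n a h g \<and>
           Factorial_Ring.irreducible g))"

section \<open>Galois extensions\<close>

definition splits_in :: "'f::field set \<Rightarrow> 'f poly \<Rightarrow> bool" where
  "splits_in K p \<longleftrightarrow> (\<exists>c xs. set xs \<subseteq> K \<and> p = Polynomial.smult c (\<Prod>x\<leftarrow>xs. [:- x, 1:]))"

text \<open>In particular the extension is algebraic.\<close>

definition separable_extension :: "'f::field set \<Rightarrow> 'f set \<Rightarrow> bool" where
  "separable_extension F K \<longleftrightarrow>
     (\<forall>x\<in>K. \<exists>p. irreducible_over F p \<and> poly p x = 0 \<and> separable_poly p)"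

definition normal_extension :: "'f::field set \<Rightarrow> 'f set \<Rightarrow> bool" where
  "normal_extension F K \<longleftrightarrow>
     (\<forall>p. irreducible_over F p \<and> (\<exists>x\<in>K. poly p x = 0) \<longrightarrow> splits_in K p)"

definition galois_extension :: "'f::field set \<Rightarrow> 'f set \<Rightarrow> bool" where
  "galois_extension F K \<longleftrightarrow>
     subfield F ring_of_type_algebra \<and> subfield K ring_of_type_algebra \<and> F \<subseteq> K \<and>
     separable_extension F K \<and> normal_extension F K"

definition galois_group :: "'f::field set \<Rightarrow> 'f set \<Rightarrow> ('f \<Rightarrow> 'f) monoid" where
  "galois_group F K = BijGroup K
     \<lparr> carrier := {\<sigma> \<in> Bij K. \<sigma> \<in> ring_hom (ring_on K) (ring_on K) \<and> (\<forall>x\<in>F. \<sigma> x = x)} \<rparr>"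

end

theory Submission
  imports Defs
begin

text \<open>
  Write \<open>L = k(x\<^sub>g : g \<in> G)\<close>, so that \<open>k(G)\<close> is the fixed field of the permutation action on \<open>L\<close>, and
  let \<open>h = \<Prod>\<^sub>g (T - x\<^sub>g)\<close>. The group permutes the roots of \<open>h\<close> simply transitively, so \<open>h\<close> is irreducible
  over \<open>k(G)\<close> and any one root generates \<open>L\<close>. The idea is to specialize this Galois extension, first
  to \<open>k(X\<^sub>0, \<dots>, X\<^sub>n\<^sub>-\<^sub>1)\<close> by means of the retraction, then to \<open>k\<close> by Hilbert's theorem, without losing
  either the group or the irreducibility.

  \<^item> The group survives every specialization. By Lagrange interpolation, a family in \<open>L\<close> indexed by
    \<open>G\<close> on which \<open>G\<close> acts by left translation consists of the values at the \<open>x\<^sub>g\<close> of one polynomial over \<open>k(G)\<close>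
    (\<open>equivariant_interpolation\<close>). In particular \<open>x\<^sub>h\<^sub>g = P\<^sub>g(x\<^sub>h)\<close> for polynomials \<open>P\<^sub>g\<close> over \<open>k(G)\<close>, and the
    inverses of the differences of the roots are polynomials in one root too. These are finitely many
    polynomial congruences modulo \<open>h\<close>. A homomorphism \<open>\<chi>\<close> into a field, defined on a subring of \<open>k(G)\<close> that
    contains their coefficients, carries them over: the roots of \<open>h\<^sup>\<chi>\<close> are distinct, are labelled
    by \<open>G\<close>, and translation of the labels is given by polynomials (\<open>orbit_specialization\<close>).
    If the specialization over \<open>k\<close> is irreducible, then all its roots lie in the field generated
    by one of them, and this field is Galois over \<open>k\<close> with group \<open>G\<close> (locale \<open>labelled_roots\<close>).

  \<^item> Irreducibility survives the passage to \<open>k(X)\<close>. Retract rationality says that there are an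
    embedding \<open>\<phi>\<close> of \<open>k(G)\<close> into \<open>k(X)\<close> and a point \<open>b\<close> with coordinates in \<open>k(G)\<close> such that every \<open>\<phi> y\<close> is
    defined at \<open>b\<close> and has the value \<open>y\<close> there (\<open>retract_rational_section\<close>). A factorization of
    \<open>h\<^sup>\<phi>\<close> over \<open>k(X)\<close> need not have coefficients that are defined at \<open>b\<close>. But it can be restricted
    to a line through \<open>b\<close> that meets the locus of its denominators properly, and on this line
    the lowest order terms at \<open>b\<close> give a factorization of \<open>h\<close> over \<open>k(G)\<close> with factors of the same degrees
    (\<open>irreducible_over_ratfun\<close>).

  So \<open>h\<^sup>\<phi>\<close> is irreducible and separable over \<open>k(X)\<close>, and Hilbert's theorem yields a point \<open>a\<close> of \<open>k\<^sup>n\<close>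
  at which it stays irreducible and at which \<open>\<phi>\<close> of all the finitely many coefficients above
  is defined. The homomorphism \<open>\<chi>\<close> is \<open>\<phi>\<close> followed by evaluation at \<open>a\<close>.
\<close>

section \<open>Homomorphisms defined on a subring\<close>

text \<open>
  Homomorphisms such as the action of \<open>G\<close> or evaluation at a point live on subrings of a field type. They
  are kept as functions on the whole type of which only the values on the subring matter.
\<close>

locale subring_set =
  fixes B :: "'a::comm_ring_1 set"
  assumes one_mem: "1 \<in> B"
    and diff_mem: "x \<in> B \<Longrightarrow> y \<in> B \<Longrightarrow> x - y \<in> B"
    and mult_mem: "x \<in> B \<Longrightarrow> y \<in> B \<Longrightarrow> x * y \<in> B"
begin

lemma zero_mem: "0 \<in> B"
  using diff_mem[OF one_mem one_mem] by simp

lemma uminus_mem: "x \<in> B \<Longrightarrow> - x \<in> B"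
  using diff_mem[OF zero_mem] by simp

lemma add_mem: "x \<in> B \<Longrightarrow> y \<in> B \<Longrightarrow> x + y \<in> B"
  using diff_mem[of x "- y"] uminus_mem[of y] by simp

lemma sum_mem: "(\<And>i. i \<in> I \<Longrightarrow> f i \<in> B) \<Longrightarrow> sum f I \<in> B"
  by (induction I rule: infinite_finite_induct) (auto simp: zero_mem add_mem)

lemma prod_mem: "(\<And>i. i \<in> I \<Longrightarrow> f i \<in> B) \<Longrightarrow> prod f I \<in> B"
  by (induction I rule: infinite_finite_induct) (auto simp: one_mem mult_mem)

lemma power_mem: "x \<in> B \<Longrightarrow> x ^ n \<in> B"
  by (induction n) (auto simp: one_mem mult_mem)

lemma subring_set_polys: "subring_set {p. \<forall>i. coeff p i \<in> B}"
proof
  show "1 \<in> {p. \<forall>i. coeff p i \<in> B}"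
    by (auto simp: coeff_pCons one_pCons zero_mem one_mem split: nat.splits)
qed (auto simp: coeff_mult diff_mem mult_mem intro!: sum_mem)

lemma const_mem_polys: "c \<in> B \<Longrightarrow> [:c:] \<in> {p. \<forall>i. coeff p i \<in> B}"
  by (auto simp: coeff_pCons zero_mem split: nat.splits)

lemma linear_mem_polys: "a \<in> B \<Longrightarrow> c \<in> B \<Longrightarrow> [:a, c:] \<in> {p. \<forall>i. coeff p i \<in> B}"
  by (auto simp: coeff_pCons zero_mem split: nat.splits)

lemma smult_mem_polys:
  "c \<in> B \<Longrightarrow> p \<in> {p. \<forall>i. coeff p i \<in> B} \<Longrightarrow> smult c p \<in> {p. \<forall>i. coeff p i \<in> B}"
  by (auto simp: mult_mem)

lemma monom_mem_polys: "c \<in> B \<Longrightarrow> Polynomial.monom c n \<in> {p. \<forall>i. coeff p i \<in> B}"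
  by (auto simp: zero_mem)

lemma poly_mem: "p \<in> {p. \<forall>i. coeff p i \<in> B} \<Longrightarrow> x \<in> B \<Longrightarrow> poly p x \<in> B"
  by (auto simp: poly_altdef intro!: sum_mem mult_mem power_mem)

lemma monic_division:
  assumes m: "m \<in> {p. \<forall>i. coeff p i \<in> B}" "lead_coeff m = 1"
    and p: "p \<in> {p. \<forall>i. coeff p i \<in> B}"
  shows "\<exists>q r. q \<in> {p. \<forall>i. coeff p i \<in> B} \<and> r \<in> {p. \<forall>i. coeff p i \<in> B} \<and>
    p = m * q + r \<and> (r = 0 \<or> degree r < degree m)"
  using p
proof (induction "degree p" arbitrary: p rule: less_induct)
  case less
  interpret P: subring_set "{p. \<forall>i. coeff p i \<in> B}"
    by (rule subring_set_polys)
  show ?case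
  proof (cases "degree m = 0 \<or> degree p < degree m")
    case True
    then show ?thesis
    proof
      assume "degree m = 0"
      then have "m = 1" using m(2) by (metis degree_eq_zeroE lead_coeff_pCons(2) one_pCons)
      then show ?thesis
        using less.prems P.zero_mem by (intro exI[of _ p] exI[of _ 0]) auto
    next
      assume "degree p < degree m"
      then show ?thesis
        using less.prems P.zero_mem by (intro exI[of _ 0] exI[of _ p]) auto
    qed
  next
    case False
    define s where "s = Polynomial.monom (lead_coeff p) (degree p - degree m)"
    define p' where "p' = p - m * s"
    have s: "s \<in> {p. \<forall>i. coeff p i \<in> B}"
      unfolding s_def by (rule monom_mem_polys) (use less.prems in auto)
    have p': "p' \<in> {p. \<forall>i. coeff p i \<in> B}"
      unfolding p'_def by (intro P.diff_mem P.mult_mem m s less.prems)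
    have "degree s \<le> degree p - degree m"
      unfolding s_def by (rule degree_monom_le)
    then have "degree (m * s) \<le> degree p"
      using degree_mult_le[of m s] False by linarith
    then have "degree p' \<le> degree p"
      unfolding p'_def by (rule degree_diff_le[OF order.refl])
    moreover have "coeff p' (degree p) = 0"
      using False m(2) unfolding p'_def s_def
      by (simp add: mult.commute[of m] coeff_monom_mult)
    ultimately have "p' = 0 \<or> degree p' < degree p"
      by (metis eq_zero_or_degree_less)
    then have "degree p' < degree p"
      using False by auto
    from less.hyps[OF this p'] obtain q r where
      "q \<in> {p. \<forall>i. coeff p i \<in> B}" "r \<in> {p. \<forall>i. coeff p i \<in> B}"
      "p' = m * q + r" "r = 0 \<or> degree r < degree m"
      by blast
    then show ?thesis
      using s by (intro exI[of _ "s + q"] exI[of _ r]) (auto simp: p'_def algebra_simps add_mem)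
  qed
qed

end

lemma subring_set_polys_over: "subring_set B \<Longrightarrow> subring_set (polys_over B)"
  unfolding polys_over_def by (rule subring_set.subring_set_polys)

text \<open>
  Division by a monic polynomial stays within the subring, and quotients are unique in the
  ambient field.
\<close>

lemma quotient_mem_polys_over:
  assumes "subring_set B" "m \<in> polys_over B" "lead_coeff m = 1" "m * q \<in> polys_over B"
  shows "q \<in> polys_over (B :: 'a::field set)"
proof -
  obtain q' r where q': "q' \<in> polys_over B" "m * q = m * q' + r" "r = 0 \<or> degree r < degree m"
    using subring_set.monic_division[OF assms(1), of m "m * q"] assms(2-4)
    unfolding polys_over_def by blast
  have "m \<noteq> 0" using assms(3) by auto
  have r: "r = m * (q - q')" using q'(2) by (simp add: algebra_simps)
  have "q - q' = 0"
  proof (rule ccontr)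
    assume "q - q' \<noteq> 0"
    then have "r \<noteq> 0" "degree r = degree m + degree (q - q')"
      using r \<open>m \<noteq> 0\<close> by (simp_all add: degree_mult_eq)
    then show False using q'(3) by simp
  qed
  then show ?thesis using q'(1) by simp
qed

locale partial_hom = subring_set B
  for B :: "'a::comm_ring_1 set" +
  fixes \<chi> :: "'a \<Rightarrow> 'b::comm_ring_1"
  assumes hom_one: "\<chi> 1 = 1"
    and hom_add: "x \<in> B \<Longrightarrow> y \<in> B \<Longrightarrow> \<chi> (x + y) = \<chi> x + \<chi> y"
    and hom_mult: "x \<in> B \<Longrightarrow> y \<in> B \<Longrightarrow> \<chi> (x * y) = \<chi> x * \<chi> y"
begin

lemma hom_zero: "\<chi> 0 = 0"
  using hom_add[OF zero_mem zero_mem] by simp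

lemma hom_uminus: "x \<in> B \<Longrightarrow> \<chi> (- x) = - \<chi> x"
  using hom_add[of x "- x"] uminus_mem[of x] hom_zero by (simp add: eq_neg_iff_add_eq_0 add.commute)

lemma hom_diff: "x \<in> B \<Longrightarrow> y \<in> B \<Longrightarrow> \<chi> (x - y) = \<chi> x - \<chi> y"
  using hom_add[of x "- y"] uminus_mem[of y] hom_uminus[of y] by simp

lemma hom_sum: "(\<And>i. i \<in> I \<Longrightarrow> f i \<in> B) \<Longrightarrow> \<chi> (sum f I) = (\<Sum>i\<in>I. \<chi> (f i))"
  by (induction I rule: infinite_finite_induct) (auto simp: hom_zero hom_add sum_mem)

lemma hom_prod: "(\<And>i. i \<in> I \<Longrightarrow> f i \<in> B) \<Longrightarrow> \<chi> (prod f I) = (\<Prod>i\<in>I. \<chi> (f i))"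
  by (induction I rule: infinite_finite_induct) (auto simp: hom_one hom_mult prod_mem)

lemma hom_power: "x \<in> B \<Longrightarrow> \<chi> (x ^ n) = \<chi> x ^ n"
  by (induction n) (auto simp: hom_one hom_mult power_mem)

lemma hom_poly:
  "p \<in> {p. \<forall>i. coeff p i \<in> B} \<Longrightarrow> x \<in> B \<Longrightarrow> \<chi> (poly p x) = poly (map_poly \<chi> p) (\<chi> x)"
proof (induction p)
  case (pCons a p)
  have "coeff (pCons a p) 0 \<in> B" "coeff (pCons a p) (Suc i) \<in> B" for i
    using pCons.prems(1) by blast+
  then have "a \<in> B" "p \<in> {p. \<forall>i. coeff p i \<in> B}" by auto
  then show ?case
    using pCons poly_mem[of p x] by (simp add: map_poly_pCons hom_zero hom_add hom_mult mult_mem)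
qed (simp add: hom_zero)

lemma partial_hom_map_poly: "partial_hom {p. \<forall>i. coeff p i \<in> B} (map_poly \<chi>)"
proof -
  interpret P: subring_set "{p. \<forall>i. coeff p i \<in> B}" by (rule subring_set_polys)
  show ?thesis
  proof
    show "map_poly \<chi> 1 = 1"
      by (simp add: one_pCons map_poly_pCons hom_zero hom_one)
    fix p q
    assume p: "p \<in> {p. \<forall>i. coeff p i \<in> B}" and q: "q \<in> {p. \<forall>i. coeff p i \<in> B}"
    show "map_poly \<chi> (p + q) = map_poly \<chi> p + map_poly \<chi> q"
      by (rule poly_eqI) (use p q in \<open>simp add: coeff_map_poly hom_zero hom_add\<close>)
    show "map_poly \<chi> (p * q) = map_poly \<chi> p * map_poly \<chi> q"
      by (rule poly_eqI)
        (use p q in \<open>simp add: coeff_map_poly hom_zero coeff_mult hom_sum hom_mult mult_mem\<close>)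
  qed
qed

lemma map_poly_smult_partial:
  "c \<in> B \<Longrightarrow> p \<in> {p. \<forall>i. coeff p i \<in> B} \<Longrightarrow> map_poly \<chi> (smult c p) = smult (\<chi> c) (map_poly \<chi> p)"
  by (rule poly_eqI) (simp add: coeff_map_poly hom_zero hom_mult)

lemma map_poly_linear: "x \<in> B \<Longrightarrow> map_poly \<chi> [:- x, 1:] = [:- \<chi> x, 1:]"
  by (simp add: map_poly_pCons hom_zero hom_one hom_uminus)

end

lemma partial_hom_UNIV: "unital_ring_hom c \<Longrightarrow> partial_hom UNIV c"
  by unfold_locales (auto simp: unital_ring_hom_def)

lemma partial_hom_subset: "partial_hom C \<chi> \<Longrightarrow> subring_set B \<Longrightarrow> B \<subseteq> C \<Longrightarrow> partial_hom B \<chi>"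
  unfolding partial_hom_def partial_hom_axioms_def by blast

lemma partial_hom_comp:
  assumes "partial_hom B \<chi>" "partial_hom C \<psi>" "\<And>x. x \<in> B \<Longrightarrow> \<chi> x \<in> C"
  shows "partial_hom B (\<lambda>x. \<psi> (\<chi> x))"
proof -
  interpret X: partial_hom B \<chi> by fact
  interpret Y: partial_hom C \<psi> by fact
  show ?thesis
    by unfold_locales (simp_all add: X.hom_one X.hom_add X.hom_mult Y.hom_one Y.hom_add Y.hom_mult assms(3))
qed

lemma partial_hom_cong:
  assumes "partial_hom B \<chi>" "\<And>x. x \<in> B \<Longrightarrow> \<psi> x = \<chi> x"
  shows "partial_hom B \<psi>"
proof -
  interpret X: partial_hom B \<chi> by fact
  show ?thesis
    by unfold_locales
      (simp_all add: assms(2) X.one_mem X.add_mem X.mult_mem X.hom_one X.hom_add X.hom_mult)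
qed

lemma partial_hom_inj_on:
  fixes \<psi> :: "'c::field \<Rightarrow> 'd::field"
  assumes "partial_hom M \<psi>" "\<And>x. x \<in> M \<Longrightarrow> inverse x \<in> M"
  shows "inj_on \<psi> M"
proof (rule inj_onI)
  interpret X: partial_hom M \<psi> by fact
  fix x y assume xy: "x \<in> M" "y \<in> M" "\<psi> x = \<psi> y"
  show "x = y"
  proof (rule ccontr)
    assume "x \<noteq> y"
    then have "\<psi> ((x - y) * inverse (x - y)) = 1" by (simp add: X.hom_one)
    then show False
      using xy assms(2)[of "x - y"] by (simp add: X.hom_mult X.hom_diff X.diff_mem del: right_inverse)
  qed
qed

section \<open>Polynomials with given simple roots\<close>

text \<open>
  The roots form a set, so every polynomial of this form has simple roots only.
\<close>

definition root_poly :: "'a::idom set \<Rightarrow> 'a poly" where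
  "root_poly S = (\<Prod>z\<in>S. [:- z, 1:])"

lemma root_poly_insert:
  "finite S \<Longrightarrow> z \<notin> S \<Longrightarrow> root_poly (insert z S) = [:- z, 1:] * root_poly S"
  unfolding root_poly_def by (rule prod.insert)

lemma root_poly_nonzero: "root_poly S \<noteq> 0"
  unfolding root_poly_def by (cases "finite S") auto

lemma degree_root_poly: "degree (root_poly S) = card S"
  unfolding root_poly_def by (cases "finite S") (auto simp: degree_prod_eq_sum_degree)

lemma lead_coeff_root_poly: "lead_coeff (root_poly S) = 1"
  unfolding root_poly_def by (subst lead_coeff_prod) simp

lemma poly_root_poly_eq_0: "finite S \<Longrightarrow> poly (root_poly S) x = 0 \<longleftrightarrow> x \<in> S"
  by (auto simp: root_poly_def poly_prod)

lemma root_poly_dvd: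
  assumes "finite S" "\<And>z. z \<in> S \<Longrightarrow> poly p z = 0"
  shows "root_poly S dvd p"
  using assms
proof (induction S arbitrary: p rule: finite_induct)
  case (insert z S)
  obtain q where q: "p = [:- z, 1:] * q"
    using insert.prems[of z] by (auto simp: poly_eq_0_iff_dvd)
  have "poly q w = 0" if "w \<in> S" for w
    using insert.prems[of w] insert.hyps(2) that q by auto
  then have "root_poly S dvd q" by (rule insert.IH)
  then show ?case
    unfolding root_poly_insert[OF insert.hyps] q by (rule mult_dvd_mono[OF dvd_refl])
qed (simp add: root_poly_def)

lemma degree_ge_card_roots:
  fixes p :: "'a::idom poly"
  assumes "finite S" "\<And>z. z \<in> S \<Longrightarrow> poly p z = 0" "p \<noteq> 0"
  shows "card S \<le> degree p"
proof -
  have "root_poly S dvd p" by (rule root_poly_dvd) (use assms in auto)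
  from dvd_imp_degree_le[OF this assms(3)] show ?thesis by (simp add: degree_root_poly)
qed

lemma eq_root_poly:
  fixes p :: "'a::idom poly"
  assumes "finite S" "\<And>z. z \<in> S \<Longrightarrow> poly p z = 0" "lead_coeff p = 1" "degree p = card S"
  shows "p = root_poly S"
proof -
  obtain q where q: "p = root_poly S * q"
    using root_poly_dvd[of S p] assms(1,2) by (auto elim: dvdE)
  have "q \<noteq> 0" using q assms(3) by auto
  then have "degree q = 0"
    using q assms(4) by (simp add: degree_mult_eq root_poly_nonzero degree_root_poly)
  moreover have "lead_coeff q = 1"
    using q assms(3) by (simp add: lead_coeff_mult lead_coeff_root_poly)
  ultimately have "q = 1" by (metis degree_eq_zeroE lead_coeff_pCons(2) one_pCons)
  then show ?thesis using q by simp
qed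

lemma rsquarefree_root_poly:
  assumes "finite S"
  shows "rsquarefree (root_poly S)"
  unfolding rsquarefree_def
proof (intro conjI allI root_poly_nonzero)
  fix a
  show "order a (root_poly S) = 0 \<or> order a (root_poly S) = 1"
  proof (cases "a \<in> S")
    case True
    have eq: "root_poly S = [:- a, 1:] * root_poly (S - {a})"
      using root_poly_insert[of "S - {a}" a] assms True by (simp add: insert_absorb)
    have "order a (root_poly (S - {a})) = 0"
      using assms by (simp add: order_0I poly_root_poly_eq_0)
    moreover have "order a [:- a, 1:] = 1"
      using order_power_n_n[of a 1] by simp
    moreover have "order a (root_poly S) = order a [:- a, 1:] + order a (root_poly (S - {a}))"
      using root_poly_nonzero[of S] unfolding eq by (rule order_mult)
    ultimately have "order a (root_poly S) = 1" by simp
    then show ?thesis ..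
  qed (simp add: order_0I poly_root_poly_eq_0 assms)
qed

lemma map_poly_root_poly:
  fixes \<psi> :: "'c::idom \<Rightarrow> 'd::idom"
  assumes "partial_hom M \<psi>" "S \<subseteq> M" "inj_on \<psi> S"
  shows "map_poly \<psi> (root_poly S) = root_poly (\<psi> ` S)"
proof -
  interpret X: partial_hom M \<psi> by fact
  interpret P: partial_hom "{p. \<forall>i. coeff p i \<in> M}" "map_poly \<psi>" by (rule X.partial_hom_map_poly)
  have "map_poly \<psi> (root_poly S) = (\<Prod>z\<in>S. map_poly \<psi> [:- z, 1:])"
    unfolding root_poly_def
    by (rule P.hom_prod, rule X.linear_mem_polys) (use assms(2) in \<open>auto intro: X.uminus_mem X.one_mem\<close>)
  also have "\<dots> = (\<Prod>z\<in>S. [:- \<psi> z, 1:])"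
    by (rule prod.cong[OF refl]) (use assms(2) in \<open>auto intro: X.map_poly_linear\<close>)
  also have "\<dots> = root_poly (\<psi> ` S)"
    unfolding root_poly_def by (simp add: prod.reindex[OF assms(3)])
  finally show ?thesis .
qed

section \<open>Irreducibility over a subfield\<close>

lemma ring_on_simps:
  "carrier (ring_on A) = A" "x \<otimes>\<^bsub>ring_on A\<^esub> y = x * y" "x \<oplus>\<^bsub>ring_on A\<^esub> y = x + y"
  "\<one>\<^bsub>ring_on A\<^esub> = 1" "\<zero>\<^bsub>ring_on A\<^esub> = 0"
  by (simp_all add: ring_of_type_algebra_def)

lemma Units_ring_on:
  fixes A :: "'a::comm_ring_1 set"
  shows "w \<in> Units (ring_on A) \<longleftrightarrow> w \<in> A \<and> (\<exists>w'\<in>A. w * w' = 1)"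
  unfolding Units_def ring_on_simps by (auto simp: mult.commute)

lemma divides_ring_on: "u divides\<^bsub>ring_on A\<^esub> p \<longleftrightarrow> (\<exists>v\<in>A. p = u * v)"
  unfolding factor_def ring_on_simps ..

lemma irreducible_over_alt:
  "irreducible_over F p \<longleftrightarrow> p \<in> polys_over F \<and> p \<noteq> 0 \<and> p \<notin> Units (ring_on (polys_over F)) \<and>
     (\<forall>u\<in>polys_over F. u divides\<^bsub>ring_on (polys_over F)\<^esub> p \<and> \<not> p divides\<^bsub>ring_on (polys_over F)\<^esub> u
        \<longrightarrow> u \<in> Units (ring_on (polys_over F)))"
  unfolding irreducible_over_def ring_irreducible_def Divisibility.irreducible_def
    properfactor_def ring_on_simps
  by blast

text \<open>
  Together with the next lemma: over a field the units of the polynomial ring are the nonzero constants,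
  which turns the ring-theoretic notion of irreducibility into one about degrees of factors.
\<close>

lemma degree_Units_polys_over:
  assumes "w \<in> Units (ring_on (polys_over F))"
  shows "degree w = 0"
proof -
  obtain w' where "w * w' = 1" using assms by (auto simp only: Units_ring_on)
  moreover from this have "w \<noteq> 0" "w' \<noteq> 0" by auto
  ultimately show ?thesis by (metis add_is_0 degree_1 degree_mult_eq)
qed

lemma Units_polys_over:
  assumes "subring_set F" "\<And>x. x \<in> F \<Longrightarrow> inverse x \<in> F"
    and w: "w \<in> polys_over F" "degree w = 0" "w \<noteq> 0"
  shows "w \<in> Units (ring_on (polys_over F))"
proof -
  obtain c where c: "w = [:c:]" using w(2) by (metis degree_eq_zeroE)
  have "coeff w 0 \<in> F" using w(1) unfolding polys_over_def by blast
  then have "c \<in> F" "c \<noteq> 0" using w(3) c by auto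
  then have "[:inverse c:] \<in> polys_over F"
    using assms(2) subring_set.const_mem_polys[OF assms(1)] unfolding polys_over_def by blast
  moreover have "w * [:inverse c:] = 1" using \<open>c \<noteq> 0\<close> by (simp add: c one_pCons)
  ultimately show ?thesis using w(1) by (auto simp only: Units_ring_on)
qed

lemma irreducible_overD:
  assumes "irreducible_over F p"
    and uv: "u \<in> polys_over F" "v \<in> polys_over F" "p = u * v"
  shows "degree u = 0 \<or> degree v = 0"
proof (cases "u \<in> Units (ring_on (polys_over F))")
  case False
  have nz: "p \<noteq> 0" using assms(1) unfolding irreducible_over_alt by blast
  have "u divides\<^bsub>ring_on (polys_over F)\<^esub> p"
    unfolding divides_ring_on using uv by blast
  then have "p divides\<^bsub>ring_on (polys_over F)\<^esub> u"
    using assms(1) False uv(1) unfolding irreducible_over_alt by blast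
  then obtain w where w: "u = p * w"
    unfolding divides_ring_on by blast
  then have "u * (1 - v * w) = 0" using uv(3) by (simp add: algebra_simps)
  moreover have "u \<noteq> 0" using uv(3) nz by auto
  ultimately have "v * w = 1" by simp
  moreover from this have "v \<noteq> 0" "w \<noteq> 0" by auto
  ultimately show ?thesis by (metis add_is_0 degree_1 degree_mult_eq)
qed (use degree_Units_polys_over in blast)

lemma irreducible_overI:
  assumes F: "subring_set F" "\<And>x. x \<in> F \<Longrightarrow> inverse x \<in> F"
    and p: "p \<in> polys_over F" "degree p > 0"
    and fact: "\<And>u v. u \<in> polys_over F \<Longrightarrow> v \<in> polys_over F \<Longrightarrow> p = u * v \<Longrightarrow>
      degree u = 0 \<or> degree v = 0"
  shows "irreducible_over F p"
  unfolding irreducible_over_alt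
proof (intro conjI ballI impI p(1))
  show "p \<noteq> 0" using p(2) by auto
  show "p \<notin> Units (ring_on (polys_over F))" using degree_Units_polys_over[of p F] p(2) by auto
  fix u
  assume u: "u \<in> polys_over F"
    and "u divides\<^bsub>ring_on (polys_over F)\<^esub> p \<and> \<not> p divides\<^bsub>ring_on (polys_over F)\<^esub> u"
  then obtain v where v: "v \<in> polys_over F" "p = u * v"
    and np: "\<not> (\<exists>w\<in>polys_over F. u = p * w)"
    unfolding divides_ring_on by blast
  have nz: "u \<noteq> 0" "v \<noteq> 0" using v(2) p(2) by auto
  have "degree v \<noteq> 0"
  proof
    assume "degree v = 0"
    then have "v \<in> Units (ring_on (polys_over F))" using Units_polys_over[OF F v(1)] nz(2) by blast
    then obtain v' where "v' \<in> polys_over F" "v * v' = 1"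
      by (auto simp only: Units_ring_on)
    then have "u = p * v'" using v(2) by (simp add: mult.assoc)
    then show False using np \<open>v' \<in> polys_over F\<close> by blast
  qed
  then have "degree u = 0" using fact[OF u v] by simp
  then show "u \<in> Units (ring_on (polys_over F))" using Units_polys_over[OF F u] nz(1) by blast
qed

lemma degree_irreducible_over:
  assumes "irreducible_over F p" "subring_set F" "\<And>x. x \<in> F \<Longrightarrow> inverse x \<in> F"
  shows "degree p > 0"
  using Units_polys_over[OF assms(2,3), of p] assms(1) unfolding irreducible_over_alt by blast

section \<open>Orbits under field automorphisms\<close>

text \<open>
  The setting shared by \<open>G\<close> acting on the rational
  function field and \<open>G\<close> acting on the Galois extension that is constructed in the end.
\<close>

locale field_action = subring_set M
  for M :: "'a::field set" +
  fixes I :: "'i set" and act :: "'i \<Rightarrow> 'a \<Rightarrow> 'a"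
  assumes inverse_mem: "x \<in> M \<Longrightarrow> inverse x \<in> M"
    and act_hom: "i \<in> I \<Longrightarrow> partial_hom M (act i)"
begin

definition fixed :: "'a set" where
  "fixed = {u \<in> M. \<forall>i\<in>I. act i u = u}"

lemma act_inverse: "i \<in> I \<Longrightarrow> x \<in> M \<Longrightarrow> act i (inverse x) = inverse (act i x)"
proof (cases "x = 0")
  assume ix: "i \<in> I" "x \<in> M" "x \<noteq> 0"
  interpret A: partial_hom M "act i" by (rule act_hom[OF ix(1)])
  have "act i x * act i (inverse x) = act i (x * inverse x)"
    using ix inverse_mem by (simp only: A.hom_mult)
  also have "\<dots> = 1" using ix by (simp add: A.hom_one)
  finally show ?thesis by (rule inverse_unique[symmetric])
qed (use partial_hom.hom_zero[OF act_hom] in simp)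

lemma fixed_subset: "fixed \<subseteq> M"
  by (auto simp: fixed_def)

lemma subring_set_fixed: "subring_set fixed"
  by unfold_locales
    (auto simp: fixed_def one_mem diff_mem mult_mem partial_hom.hom_one[OF act_hom]
      partial_hom.hom_diff[OF act_hom] partial_hom.hom_mult[OF act_hom])

lemma inverse_mem_fixed: "x \<in> fixed \<Longrightarrow> inverse x \<in> fixed"
  by (auto simp: fixed_def inverse_mem act_inverse)

lemma polys_over_fixed_iff:
  "p \<in> polys_over fixed \<longleftrightarrow> p \<in> polys_over M \<and> (\<forall>i\<in>I. map_poly (act i) p = p)"
  by (auto simp: polys_over_def fixed_def poly_eq_iff coeff_map_poly
      partial_hom.hom_zero[OF act_hom])

lemma root_act:
  assumes "p \<in> polys_over fixed" "x \<in> M" "i \<in> I" "poly p x = 0"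
  shows "poly p (act i x) = 0"
proof -
  interpret A: partial_hom M "act i" by (rule act_hom[OF assms(3)])
  have p: "p \<in> polys_over M" "map_poly (act i) p = p"
    using assms(1,3) by (auto simp: polys_over_fixed_iff)
  have "poly p (act i x) = act i (poly p x)"
    using A.hom_poly[of p x] p assms(2) by (simp add: polys_over_def)
  then show ?thesis using assms(4) A.hom_zero by simp
qed

lemma act_image_eq:
  assumes "finite S" "S \<subseteq> M" "i \<in> I" "act i ` S \<subseteq> S"
  shows "inj_on (act i) S" "act i ` S = S"
proof -
  show "inj_on (act i) S"
    by (rule inj_on_subset[OF partial_hom_inj_on[OF act_hom[OF assms(3)] inverse_mem] assms(2)])
  then show "act i ` S = S" using assms(1,4) by (simp add: endo_inj_surj)
qed

lemma root_poly_fixed: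
  assumes "finite S" "S \<subseteq> M" "\<And>i. i \<in> I \<Longrightarrow> act i ` S \<subseteq> S"
  shows "root_poly S \<in> polys_over fixed"
  unfolding polys_over_fixed_iff
proof (intro conjI ballI)
  interpret P: subring_set "polys_over M" by (rule subring_set_polys_over) (rule subring_set_axioms)
  show "root_poly S \<in> polys_over M"
    unfolding root_poly_def
    by (rule P.prod_mem, unfold polys_over_def, rule linear_mem_polys)
      (use assms(2) in \<open>auto intro: uminus_mem one_mem\<close>)
  fix i assume i: "i \<in> I"
  note S = act_image_eq[OF assms(1,2) i assms(3)[OF i]]
  show "map_poly (act i) (root_poly S) = root_poly S"
    using map_poly_root_poly[OF act_hom[OF i] assms(2) S(1)] S(2) by simp
qed

lemma root_poly_dvd_fixed:
  assumes "finite S" "S \<subseteq> M" "x \<in> S" "\<And>y. y \<in> S \<Longrightarrow> \<exists>i\<in>I. act i x = y"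
    and "p \<in> polys_over fixed" "poly p x = 0"
  shows "root_poly S dvd p"
proof (rule root_poly_dvd[OF assms(1)])
  fix y assume "y \<in> S"
  then obtain i where "i \<in> I" "act i x = y" using assms(4) by blast
  then show "poly p y = 0" using root_act[OF assms(5) _ _ assms(6), of i] assms(2,3) by blast
qed

text \<open>
  A factor with coefficients in the fixed field that has one root in \<open>S\<close> has all of them, by
  transitivity; so one of the two factors of \<open>root_poly S\<close> already has full degree.
\<close>

lemma root_poly_irreducible:
  assumes S: "finite S" "S \<subseteq> M" "S \<noteq> {}"
    and stable: "\<And>i. i \<in> I \<Longrightarrow> act i ` S \<subseteq> S"
    and trans: "\<And>x y. x \<in> S \<Longrightarrow> y \<in> S \<Longrightarrow> \<exists>i\<in>I. act i x = y"
  shows "irreducible_over fixed (root_poly S)"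
proof (rule irreducible_overI[OF subring_set_fixed inverse_mem_fixed])
  show "root_poly S \<in> polys_over fixed" by (rule root_poly_fixed) (use S stable in auto)
  show "degree (root_poly S) > 0" using S by (simp add: degree_root_poly card_gt_0_iff)
  have full: "card S \<le> degree w" if "w \<in> polys_over fixed" "x \<in> S" "poly w x = 0" "w \<noteq> 0" for w x
  proof -
    have "root_poly S dvd w"
      by (rule root_poly_dvd_fixed[of S x]) (use S trans that in auto)
    then show ?thesis using dvd_imp_degree_le[OF _ that(4)] by (fastforce simp: degree_root_poly)
  qed
  fix u v
  assume uv: "u \<in> polys_over fixed" "v \<in> polys_over fixed" "root_poly S = u * v"
  have nz: "u \<noteq> 0" "v \<noteq> 0" using uv(3) root_poly_nonzero[of S] by auto
  have "card S = degree u + degree v"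
    using uv(3) nz by (metis degree_root_poly degree_mult_eq)
  moreover obtain x where x: "x \<in> S" using S(3) by blast
  have "poly u x = 0 \<or> poly v x = 0"
    using poly_root_poly_eq_0[OF S(1), of x] x uv(3) by simp
  then have "card S \<le> degree u \<or> card S \<le> degree v"
    using full[OF uv(1) x] full[OF uv(2) x] nz by blast
  ultimately show "degree u = 0 \<or> degree v = 0" by linarith
qed

end

section \<open>A Galois extension from a labelled root set\<close>

text \<open>
  A nonzero element of least degree in the ideal generated by \<open>p\<close> and \<open>q\<close> divides both of them. Since \<open>q\<close> is
  irreducible and does not divide \<open>p\<close>, it is a unit.
\<close>

lemma bezout_irreducible:
  fixes p q :: "'a::field poly"
  assumes "Factorial_Ring.irreducible q" "\<not> q dvd p"
  shows "\<exists>a b. a * p + b * q = 1"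
proof -
  define S where "S = {a * p + b * q | a b. True}"
  have S_mult: "c * x \<in> S" if "x \<in> S" for c x
  proof -
    obtain a b where "x = a * p + b * q" using \<open>x \<in> S\<close> by (auto simp: S_def)
    then have "c * x = (c * a) * p + (c * b) * q" by (simp add: algebra_simps)
    then show ?thesis unfolding S_def by blast
  qed
  have S_diff: "x - y \<in> S" if "x \<in> S" "y \<in> S" for x y
  proof -
    obtain a b a' b' where "x = a * p + b * q" "y = a' * p + b' * q"
      using \<open>x \<in> S\<close> \<open>y \<in> S\<close> by (auto simp: S_def)
    then have "x - y = (a - a') * p + (b - b') * q" by (simp add: algebra_simps)
    then show ?thesis unfolding S_def by blast
  qed
  have "q = 0 * p + 1 * q" "p = 1 * p + 0 * q" by simp_all
  then have pq: "q \<in> S" "p \<in> S" unfolding S_def by blast+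
  have "q \<noteq> 0" using assms(1) by auto
  with pq(1) have "\<exists>m. (m \<in> S \<and> m \<noteq> 0) \<and> (\<forall>x. x \<in> S \<and> x \<noteq> 0 \<longrightarrow> degree m \<le> degree x)"
    by (intro ex_has_least_nat) auto
  then obtain m where m: "m \<in> S" "m \<noteq> 0"
    and least: "\<And>x. x \<in> S \<Longrightarrow> x \<noteq> 0 \<Longrightarrow> degree m \<le> degree x"
    by blast
  have dvd: "m dvd x" if "x \<in> S" for x
  proof -
    have "x mod m = x - (x div m) * m" by (rule minus_div_mult_eq_mod[symmetric])
    then have "x mod m \<in> S" using S_diff S_mult m(1) that by simp
    then have "x mod m = 0"
      using least[of "x mod m"] degree_mod_less[OF m(2), of x] by fastforce
    then show ?thesis by (simp add: mod_eq_0_iff_dvd)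
  qed
  obtain t where t: "q = m * t" using dvd[OF pq(1)] by blast
  have "\<not> t dvd 1"
  proof
    assume "t dvd 1"
    then obtain t' where "1 = t * t'" by blast
    then have "m = q * t'" by (simp add: t mult.assoc)
    then show False using dvd[OF pq(2)] assms(2) by (metis dvd_triv_left dvd_trans)
  qed
  then have "m dvd 1" using irreducibleD[OF assms(1) t] by blast
  then obtain c where "1 = m * c" by blast
  then have "1 \<in> S" using S_mult[OF m(1), of c] by (simp add: mult.commute)
  then show ?thesis by (auto simp: S_def)
qed

lemma partial_hom_to_ac: "partial_hom UNIV to_ac"
  by unfold_locales simp_all

lemma partial_hom_map_to_ac: "partial_hom UNIV (map_poly to_ac)"
  using partial_hom.partial_hom_map_poly[OF partial_hom_to_ac] by simp

lemma subfield_ring_of_type_algebra: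
  fixes K :: "'a::field set"
  assumes "subring_set K" "\<And>x. x \<in> K \<Longrightarrow> inverse x \<in> K"
  shows "subfield K ring_of_type_algebra"
proof -
  let ?R = "ring_of_type_algebra :: 'a ring"
  interpret K: subring_set K by fact
  interpret R: field ?R by (rule field_from_type_algebra)
  have R: "carrier ?R = UNIV" "\<one>\<^bsub>?R\<^esub> = 1" "\<zero>\<^bsub>?R\<^esub> = 0"
    "\<And>x y. x \<otimes>\<^bsub>?R\<^esub> y = x * y" "\<And>x y. x \<oplus>\<^bsub>?R\<^esub> y = x + y"
    by (simp_all add: ring_of_type_algebra_def)
  have minus: "\<ominus>\<^bsub>?R\<^esub> x = - x" for x
    by (rule R.minus_equality) (simp_all add: R)
  have inv: "inv\<^bsub>?R\<^esub> x = inverse x" if "x \<noteq> 0" for x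
    by (rule R.comm_inv_char) (use that in \<open>simp_all add: R\<close>)
  show ?thesis
  proof (rule R.subfieldI')
    show "subring K ?R"
      by (rule R.subringI) (auto simp: R minus K.one_mem K.uminus_mem K.mult_mem K.add_mem)
    show "inv\<^bsub>?R\<^esub> k \<in> K" if "k \<in> K - {\<zero>\<^bsub>?R\<^esub>}" for k
      using that assms(2) by (simp add: R inv)
  qed
qed

text \<open>
  The roots of an irreducible polynomial \<open>q\<close> are labelled by \<open>G\<close> in such a way that right translation of the
  labels is a polynomial map over \<open>k\<close>. Then the field \<open>k(r \<one>)\<close> contains all roots, and \<open>r \<one> \<mapsto> r g\<close> defines
  an automorphism of it. Since left and right translations commute, \<open>g\<close> and \<open>h\<close> compose to
  \<open>g \<otimes> h\<close> in this order: \<open>r h = P\<^sub>h (r \<one>)\<close> is sent to \<open>P\<^sub>h (r g) = r (g \<otimes> h)\<close>.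
\<close>

locale labelled_roots = group G for G :: "('g, 'b) monoid_scheme" (structure) +
  fixes q :: "'k::field poly" and r :: "'g \<Rightarrow> 'k alg_closure"
  assumes finite_G: "finite (carrier G)"
    and irred: "Factorial_Ring.irreducible q"
    and inj_r: "inj_on r (carrier G)"
    and q_eq: "map_poly to_ac q = root_poly (r ` carrier G)"
    and translate: "g \<in> carrier G \<Longrightarrow>
      \<exists>P. \<forall>h\<in>carrier G. poly (map_poly to_ac P) (r h) = r (h \<otimes> g)"
begin

definition ev :: "'g \<Rightarrow> 'k poly \<Rightarrow> 'k alg_closure" where
  "ev g p = poly (map_poly to_ac p) (r g)"

sublocale mp: partial_hom UNIV "map_poly (to_ac :: 'k \<Rightarrow> _)"
  by (rule partial_hom_map_to_ac)

lemma ev_simps: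
  "ev g (p + p') = ev g p + ev g p'" "ev g (p - p') = ev g p - ev g p'"
  "ev g (p * p') = ev g p * ev g p'" "ev g 1 = 1" "ev g 0 = 0" "ev g [:c:] = to_ac c"
  "ev g [:0, 1:] = r g"
  by (simp_all add: ev_def mp.hom_add mp.hom_diff mp.hom_mult mp.hom_one map_poly_pCons)

text \<open>
  All the roots have the same minimal polynomial \<open>q\<close>. This makes \<open>\<sigma> g\<close> below independent of the
  polynomial that is chosen.
\<close>

lemma ev_eq_0_iff: "g \<in> carrier G \<Longrightarrow> ev g p = 0 \<longleftrightarrow> q dvd p"
proof
  assume g: "g \<in> carrier G"
  have q0: "ev g q = 0" using g by (simp add: ev_def q_eq poly_root_poly_eq_0 finite_G)
  show "ev g p = 0" if "q dvd p" using that q0 by (auto simp: ev_simps)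
  assume p0: "ev g p = 0"
  show "q dvd p"
  proof (rule ccontr)
    assume "\<not> q dvd p"
    then obtain a b where "a * p + b * q = 1" using bezout_irreducible[OF irred] by blast
    then have "ev g (a * p + b * q) = 1" by (simp add: ev_simps)
    then show False using p0 q0 by (simp add: ev_simps)
  qed
qed

definition K :: "'k alg_closure set" where
  "K = range (ev \<one>)"

definition \<sigma> :: "'g \<Rightarrow> 'k alg_closure \<Rightarrow> 'k alg_closure" where
  "\<sigma> g y = ev g (SOME p. y = ev \<one> p)"

lemma \<sigma>_ev:
  assumes "g \<in> carrier G"
  shows "\<sigma> g (ev \<one> p) = ev g p"
proof -
  define p' where "p' = (SOME p'. ev \<one> p = ev \<one> p')"
  have "ev \<one> p = ev \<one> p'" unfolding p'_def by (rule someI[of _ p]) simp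
  then have "ev \<one> (p - p') = 0" by (simp add: ev_simps)
  then have "ev g (p - p') = 0" using ev_eq_0_iff assms by simp
  then show ?thesis by (simp add: \<sigma>_def ev_simps flip: p'_def)
qed

lemma degree_q: "degree q = card (carrier G)"
proof -
  have "degree (map_poly to_ac q) = degree q"
    by (rule degree_map_poly) (metis inj_to_ac injD to_ac_0)
  then show ?thesis by (simp add: q_eq degree_root_poly card_image inj_r)
qed

lemma r_mem_K: "g \<in> carrier G \<Longrightarrow> r g \<in> K"
  using translate[of g] l_one[of g] one_closed unfolding K_def ev_def by (metis rangeI)

lemma subring_set_K: "subring_set K"
proof
  show "1 \<in> K" unfolding K_def by (metis ev_simps(4) rangeI)
  fix x y assume "x \<in> K" "y \<in> K"
  then obtain p p' where "x = ev \<one> p" "y = ev \<one> p'" by (auto simp: K_def)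
  then have "x - y = ev \<one> (p - p')" "x * y = ev \<one> (p * p')" by (simp_all add: ev_simps)
  then show "x - y \<in> K" "x * y \<in> K" by (simp_all add: K_def)
qed

lemma inverse_mem_K:
  assumes "x \<in> K"
  shows "inverse x \<in> K"
proof (cases "x = 0")
  case False
  obtain p where p: "x = ev \<one> p" using assms by (auto simp: K_def)
  have "\<not> q dvd p" using False p ev_eq_0_iff[of \<one> p] by simp
  then obtain a b where "a * p + b * q = 1" using bezout_irreducible[OF irred] by blast
  then have "ev \<one> (a * p + b * q) = 1" by (simp add: ev_simps)
  moreover have "ev \<one> q = 0" using ev_eq_0_iff[of \<one> q] by simp
  ultimately have "x * ev \<one> a = 1" by (simp add: ev_simps p mult.commute)
  then have "inverse x = ev \<one> a" by (rule inverse_unique)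
  then show ?thesis by (simp add: K_def)
qed (use assms in simp)

sublocale field_action K "carrier G" \<sigma>
proof (intro field_action.intro subring_set_K field_action_axioms.intro inverse_mem_K)
  fix g assume g: "g \<in> carrier G"
  have \<sigma>: "\<sigma> g (ev \<one> p + ev \<one> p') = ev g p + ev g p'" "\<sigma> g (ev \<one> p * ev \<one> p') = ev g p * ev g p'" for p p'
    using \<sigma>_ev[OF g, of "p + p'"] \<sigma>_ev[OF g, of "p * p'"] by (simp_all add: ev_simps)
  show "partial_hom K (\<sigma> g)"
  proof (intro partial_hom.intro subring_set_K partial_hom_axioms.intro)
    show "\<sigma> g 1 = 1" using \<sigma>_ev[OF g, of 1] by (simp add: ev_simps)
  qed (auto simp: K_def \<sigma> \<sigma>_ev[OF g])
qed assumption

text \<open>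
  If \<open>Q\<close> is the polynomial for translation by \<open>h\<close>, then \<open>p \<circ> Q\<close> has at each root \<open>r g\<close> the value of \<open>p\<close> at
  \<open>r (g \<otimes> h)\<close>.
\<close>

lemma \<sigma>_compose:
  assumes "g \<in> carrier G" "h \<in> carrier G" "y \<in> K"
  shows "\<sigma> g y \<in> K" "\<sigma> g (\<sigma> h y) = \<sigma> (g \<otimes> h) y"
proof -
  obtain p where p: "y = ev \<one> p" using assms(3) by (auto simp: K_def)
  have *: "\<exists>P. ev h p = ev \<one> P \<and> (\<forall>g\<in>carrier G. ev g P = ev (g \<otimes> h) p)" if h: "h \<in> carrier G" for h
  proof -
    obtain Q where Q: "\<And>g. g \<in> carrier G \<Longrightarrow> poly (map_poly to_ac Q) (r g) = r (g \<otimes> h)"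
      using translate[OF h] by blast
    have "ev g (pcompose p Q) = ev (g \<otimes> h) p" if "g \<in> carrier G" for g
    proof -
      have "map_poly to_ac (pcompose p Q) = pcompose (map_poly to_ac p) (map_poly to_ac Q)"
        by (induction p) (simp_all add: pcompose_pCons mp.hom_add mp.hom_mult map_poly_pCons)
      then show ?thesis using Q[OF that] by (simp add: ev_def poly_pcompose)
    qed
    then show ?thesis using h by (intro exI[of _ "pcompose p Q"]) simp
  qed
  show "\<sigma> g y \<in> K" using *[OF assms(1)] by (auto simp: p \<sigma>_ev assms K_def)
  obtain P where "ev h p = ev \<one> P" "ev g P = ev (g \<otimes> h) p" using *[OF assms(2)] assms(1) by blast
  then show "\<sigma> g (\<sigma> h y) = \<sigma> (g \<otimes> h) y" using assms by (simp add: p \<sigma>_ev)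
qed

lemma \<sigma>_one: "y \<in> K \<Longrightarrow> \<sigma> \<one> y = y"
  by (auto simp: K_def \<sigma>_ev)

text \<open>
  A fixed element \<open>p (r \<one>)\<close>, with \<open>p\<close> reduced modulo \<open>q\<close>, is the common value of \<open>p\<close> at \<open>card (carrier G)\<close> distinct
  points. As the degree of \<open>p\<close> is smaller, \<open>p\<close> is constant.
\<close>

lemma fixed_eq: "fixed = range to_ac"
proof
  show "range to_ac \<subseteq> fixed"
  proof
    fix y :: "'k alg_closure" assume "y \<in> range to_ac"
    then obtain c where "y = to_ac c" by blast
    then have y: "y = ev g [:c:]" for g by (simp add: ev_simps)
    have "\<sigma> g y = y" if "g \<in> carrier G" for g using \<sigma>_ev[OF that, of "[:c:]"] y by metis
    moreover have "y \<in> K" using y[of \<one>] by (simp add: K_def)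
    ultimately show "y \<in> fixed" by (simp add: fixed_def)
  qed
  show "fixed \<subseteq> range to_ac"
  proof
    fix y assume y: "y \<in> fixed"
    then obtain p where p: "y = ev \<one> p" using fixed_subset unfolding K_def by blast
    have "q \<noteq> 0" using irred by auto
    define p' where "p' = p mod q"
    have "p = p div q * q + p'" by (simp add: p'_def)
    then have ev_p: "ev g p = ev g p'" if "g \<in> carrier G" for g
      using ev_eq_0_iff[OF that, of q] by (metis add_0 dvd_refl ev_simps(1,3) mult_zero_right)
    define w where "w = map_poly to_ac p' - [:y:]"
    have "poly w z = 0" if z: "z \<in> r ` carrier G" for z
    proof -
      obtain g where g: "g \<in> carrier G" "z = r g" using z by blast
      have "ev g p' = y" using y g \<sigma>_ev[OF g(1), of p] ev_p by (simp add: fixed_def p)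
      then show ?thesis by (simp add: w_def ev_def g(2))
    qed
    then have *: "w \<noteq> 0 \<Longrightarrow> card (r ` carrier G) \<le> degree w"
      by (intro degree_ge_card_roots) (use finite_G in auto)
    have "degree q > 0"
      using degree_q finite_G one_closed by (auto simp: card_gt_0_iff)
    then have "degree p' < degree q"
      unfolding p'_def using degree_mod_less[OF \<open>q \<noteq> 0\<close>, of p] by auto
    then have "degree (map_poly to_ac p') < degree q"
      using map_poly_degree_leq[of to_ac p'] by simp
    then have "degree w < degree q"
      unfolding w_def by (intro degree_diff_less) (use \<open>degree q > 0\<close> in auto)
    then have "w = 0" using * by (fastforce simp: card_image inj_r degree_q)
    then have "coeff (map_poly to_ac p') 0 = y" by (simp add: w_def)
    then show "y \<in> range to_ac" by (auto simp: coeff_map_poly)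
  qed
qed

definition conjugates :: "'k alg_closure \<Rightarrow> 'k alg_closure set" where
  "conjugates y = (\<lambda>g. \<sigma> g y) ` carrier G"

lemma conjugates:
  assumes "y \<in> K"
  shows "finite (conjugates y)" "conjugates y \<subseteq> K" "y \<in> conjugates y"
    and "g \<in> carrier G \<Longrightarrow> \<sigma> g ` conjugates y \<subseteq> conjugates y"
    and "x \<in> conjugates y \<Longrightarrow> z \<in> conjugates y \<Longrightarrow> \<exists>g\<in>carrier G. \<sigma> g x = z"
proof -
  show "finite (conjugates y)" by (simp add: conjugates_def finite_G)
  show "conjugates y \<subseteq> K" using \<sigma>_compose(1)[OF _ one_closed assms] by (auto simp: conjugates_def)
  show "y \<in> conjugates y" using \<sigma>_one[OF assms] one_closed unfolding conjugates_def by (metis imageI)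
  show "\<sigma> g ` conjugates y \<subseteq> conjugates y" if "g \<in> carrier G"
    using \<sigma>_compose(2)[OF that _ assms] that by (auto simp: conjugates_def)
  show "\<exists>g\<in>carrier G. \<sigma> g x = z" if xz: "x \<in> conjugates y" "z \<in> conjugates y"
  proof -
    obtain g h where gh: "g \<in> carrier G" "h \<in> carrier G" "x = \<sigma> g y" "z = \<sigma> h y"
      using xz by (auto simp: conjugates_def)
    then have "\<sigma> (h \<otimes> inv g) x = z"
      using \<sigma>_compose(2)[of "h \<otimes> inv g" g y] assms by (simp add: m_assoc)
    then show ?thesis using gh by (intro bexI[of _ "h \<otimes> inv g"]) auto
  qed
qed

text \<open>
  This is the minimal polynomial of \<open>y\<close>; it has simple roots, all in \<open>K\<close>, which is why the
  extension is separable and normal.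
\<close>

lemma conjugates_irreducible:
  assumes "y \<in> K"
  shows "irreducible_over (range to_ac) (root_poly (conjugates y))"
  using root_poly_irreducible[of "conjugates y"] conjugates[OF assms] by (fastforce simp: fixed_eq)

lemma galois_extension_K: "galois_extension (range to_ac) K"
  unfolding galois_extension_def
proof (intro conjI)
  have F: "subring_set (range to_ac :: 'k alg_closure set)"
    "\<And>x :: 'k alg_closure. x \<in> range to_ac \<Longrightarrow> inverse x \<in> range to_ac"
    using subring_set_fixed inverse_mem_fixed by (simp_all add: fixed_eq)
  show "subfield (range to_ac :: 'k alg_closure set) ring_of_type_algebra"
    by (rule subfield_ring_of_type_algebra[OF F])
  show "subfield K ring_of_type_algebra"
    by (rule subfield_ring_of_type_algebra[OF subring_set_K inverse_mem_K])
  show "range to_ac \<subseteq> K" using fixed_subset by (simp add: fixed_eq)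
  show "separable_extension (range to_ac) K"
    unfolding separable_extension_def
  proof
    fix y assume y: "y \<in> K"
    have "map_poly to_ac (root_poly (conjugates y)) = root_poly (to_ac ` conjugates y)"
      by (rule map_poly_root_poly[OF partial_hom_to_ac]) (auto intro: inj_on_subset[OF inj_to_ac])
    then have "separable_poly (root_poly (conjugates y))"
      using conjugates(1)[OF y] by (simp add: separable_poly_def rsquarefree_root_poly)
    then show "\<exists>p. irreducible_over (range to_ac) p \<and> poly p y = 0 \<and> separable_poly p"
      using conjugates[OF y] conjugates_irreducible[OF y]
      by (intro exI[of _ "root_poly (conjugates y)"]) (simp add: poly_root_poly_eq_0)
  qed
  show "normal_extension (range to_ac) K"
    unfolding normal_extension_def
  proof (intro allI impI)
    fix p assume p: "irreducible_over (range to_ac) p \<and> (\<exists>x\<in>K. poly p x = 0)"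
    then obtain y where y: "y \<in> K" "poly p y = 0" by blast
    let ?m = "root_poly (conjugates y)"
    have pF: "p \<in> polys_over (range to_ac)" using p by (simp add: irreducible_over_def)
    have mF: "?m \<in> polys_over (range to_ac)"
      using conjugates_irreducible[OF y(1)] by (simp add: irreducible_over_def)
    have "?m dvd p"
      by (rule root_poly_dvd_fixed[of _ y])
        (use conjugates[OF y(1)] pF y(2) in \<open>auto simp: fixed_eq\<close>)
    then obtain t where t: "p = ?m * t" by blast
    have "t \<in> polys_over (range to_ac)"
      by (rule quotient_mem_polys_over[OF F(1) mF lead_coeff_root_poly]) (use t pF in simp)
    then have "degree ?m = 0 \<or> degree t = 0"
      by (intro irreducible_overD[OF conjunct1[OF p] mF _ t])
    moreover have "degree ?m \<noteq> 0"
      using conjugates(1,3)[OF y(1)] by (auto simp: degree_root_poly)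
    ultimately obtain c where c: "t = [:c:]" by (metis degree_eq_zeroE)
    obtain xs where xs: "set xs = conjugates y" "distinct xs"
      using finite_distinct_list[OF conjugates(1)[OF y(1)]] by blast
    have "?m = (\<Prod>x\<leftarrow>xs. [:- x, 1:])"
      unfolding root_poly_def xs(1)[symmetric] by (rule prod.distinct_set_conv_list[OF xs(2)])
    then have "p = smult c (\<Prod>x\<leftarrow>xs. [:- x, 1:])" using t c by simp
    then show "splits_in K p"
      using xs(1) conjugates(2)[OF y(1)] unfolding splits_in_def by blast
  qed
qed

text \<open>
  The automorphisms \<open>\<sigma> g\<close> are distinct because the roots \<open>r g\<close> are, and there are no others because an
  automorphism over \<open>k\<close> is determined by the root of \<open>q\<close> to which it sends \<open>r \<one>\<close>.
\<close>

lemma galois_group_K: "galois_group (range to_ac) K \<cong> G"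
proof -
  let ?A = "galois_group (range to_ac) K"
  define \<Phi> where "\<Phi> g = restrict (\<sigma> g) K" for g
  have \<Phi>_Bij: "\<Phi> g \<in> Bij K" if g: "g \<in> carrier G" for g
  proof -
    have "bij_betw (\<sigma> g) K K"
      by (rule bij_betw_byWitness[of _ "\<sigma> (inv g)"])
        (use g \<sigma>_compose \<sigma>_one in \<open>auto simp: \<sigma>_compose(2)\<close>)
    then show ?thesis by (simp add: Bij_def \<Phi>_def bij_betw_restrict_eq)
  qed
  have carr: "carrier ?A = {\<sigma> \<in> Bij K. \<sigma> \<in> ring_hom (ring_on K) (ring_on K) \<and> (\<forall>x\<in>range to_ac. \<sigma> x = x)}"
    by (simp add: galois_group_def)
  have \<Phi>_mem: "\<Phi> g \<in> carrier ?A" if g: "g \<in> carrier G" for g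
  proof -
    interpret A: partial_hom K "\<sigma> g" by (rule act_hom[OF g])
    have "\<Phi> g \<in> ring_hom (ring_on K) (ring_on K)"
      by (rule ring_hom_memI)
        (auto simp: \<Phi>_def ring_of_type_algebra_def A.hom_add A.hom_mult A.hom_one
          mult_mem add_mem one_mem \<sigma>_compose(1)[OF g one_closed])
    moreover have "\<Phi> g x = x" if "x \<in> range to_ac" for x
      using that g by (auto simp: \<Phi>_def fixed_def simp flip: fixed_eq)
    ultimately show ?thesis using \<Phi>_Bij[OF g] by (simp add: carr)
  qed
  have r_ev: "r g = ev g [:0, 1:]" for g by (simp add: ev_simps)
  have \<sigma>_r: "\<sigma> g (r \<one>) = r g" if "g \<in> carrier G" for g
    using \<sigma>_ev[OF that] by (simp add: r_ev)
  have "\<Phi> \<in> iso G ?A"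
  proof (rule isoI)
    show "\<Phi> \<in> hom G ?A"
    proof (rule homI)
      show "\<Phi> (g \<otimes> h) = \<Phi> g \<otimes>\<^bsub>?A\<^esub> \<Phi> h" if gh: "g \<in> carrier G" "h \<in> carrier G" for g h
      proof -
        have "\<Phi> g \<otimes>\<^bsub>?A\<^esub> \<Phi> h = compose K (\<Phi> g) (\<Phi> h)"
          using \<Phi>_Bij gh by (simp add: galois_group_def BijGroup_def)
        also have "\<dots> = \<Phi> (g \<otimes> h)"
          using gh \<sigma>_compose by (auto simp: compose_def \<Phi>_def)
        finally show ?thesis by simp
      qed
    qed (rule \<Phi>_mem)
    show "bij_betw \<Phi> (carrier G) (carrier ?A)"
    proof (rule bij_betw_imageI)
      show "inj_on \<Phi> (carrier G)"
      proof (rule inj_onI)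
        fix g h assume gh: "g \<in> carrier G" "h \<in> carrier G" "\<Phi> g = \<Phi> h"
        then have "\<Phi> g (r \<one>) = \<Phi> h (r \<one>)" by simp
        then show "g = h" using gh r_mem_K \<sigma>_r inj_r by (auto simp: \<Phi>_def dest: inj_onD)
      qed
      have "\<tau> \<in> \<Phi> ` carrier G" if \<tau>: "\<tau> \<in> carrier ?A" for \<tau>
      proof -
        have \<tau>B: "\<tau> \<in> Bij K" and \<tau>R: "\<tau> \<in> ring_hom (ring_on K) (ring_on K)"
          and \<tau>F: "\<And>c. \<tau> (to_ac c) = to_ac c"
          using \<tau> by (auto simp: carr)
        have \<tau>h: "partial_hom K \<tau>"
          using ring_hom_one[OF \<tau>R] ring_hom_add[OF \<tau>R] ring_hom_mult[OF \<tau>R]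
          by (intro partial_hom.intro subring_set_K partial_hom_axioms.intro)
            (simp_all add: ring_of_type_algebra_def)
        interpret T: partial_hom K \<tau> by fact
        have FK: "to_ac c \<in> K" for c :: 'k using fixed_subset by (auto simp: fixed_eq)
        have r1: "r \<one> \<in> K" by (rule r_mem_K) simp
        \<comment> \<open>An automorphism over \<open>k\<close> commutes with polynomials over \<open>k\<close>.\<close>
        have \<tau>_ev: "\<tau> (ev \<one> p) = poly (map_poly to_ac p) (\<tau> (r \<one>))" for p
        proof -
          have "map_poly \<tau> (map_poly to_ac p) = map_poly to_ac p"
            by (rule poly_eqI) (simp add: coeff_map_poly T.hom_zero \<tau>F)
          then show ?thesis
            using T.hom_poly[of "map_poly to_ac p" "r \<one>"] r1 FK by (simp add: ev_def coeff_map_poly)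
        qed
        have "ev \<one> q = 0" by (simp add: ev_eq_0_iff)
        then have "poly (map_poly to_ac q) (\<tau> (r \<one>)) = 0" using \<tau>_ev[of q] T.hom_zero by simp
        then obtain g where g: "g \<in> carrier G" "\<tau> (r \<one>) = r g"
          by (auto simp: q_eq poly_root_poly_eq_0 finite_G)
        have "\<tau> = \<Phi> g"
        proof (rule extensionalityI[of _ K])
          show "\<tau> \<in> extensional K" by (rule Bij_imp_extensional[OF \<tau>B])
          show "\<tau> y = \<Phi> g y" if "y \<in> K" for y
          proof -
            obtain p where "y = ev \<one> p" using \<open>y \<in> K\<close> by (auto simp: K_def)
            then show ?thesis using that \<tau>_ev[of p] g \<sigma>_ev[OF g(1), of p] by (simp add: \<Phi>_def ev_def)
          qed
        qed (simp add: \<Phi>_def)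
        then show ?thesis using g(1) by blast
      qed
      then show "\<Phi> ` carrier G = carrier ?A" using \<Phi>_mem by blast
    qed
  qed
  then have "G \<cong> ?A" by (auto simp: is_iso_def)
  then show ?thesis by (rule iso_sym)
qed

end

section \<open>Specialization of a regular orbit\<close>

lemma (in subring_set) pcompose_mem_polys:
  "p \<in> {p. \<forall>i. coeff p i \<in> B} \<Longrightarrow> q \<in> {p. \<forall>i. coeff p i \<in> B} \<Longrightarrow>
    pcompose p q \<in> {p. \<forall>i. coeff p i \<in> B}"
proof (induction p)
  case (pCons a p)
  interpret P: subring_set "{p. \<forall>i. coeff p i \<in> B}" by (rule subring_set_polys)
  have "coeff (pCons a p) 0 \<in> B" "coeff (pCons a p) (Suc i) \<in> B" for i
    using pCons.prems(1) by blast+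
  then have "a \<in> B" "p \<in> {p. \<forall>i. coeff p i \<in> B}" by auto
  then show ?case
    unfolding pcompose_pCons by (intro P.add_mem P.mult_mem const_mem_polys pCons.IH pCons.prems)
qed (simp add: zero_mem)

lemma (in partial_hom) map_poly_pcompose:
  "p \<in> {p. \<forall>i. coeff p i \<in> B} \<Longrightarrow> q \<in> {p. \<forall>i. coeff p i \<in> B} \<Longrightarrow>
    map_poly \<chi> (pcompose p q) = pcompose (map_poly \<chi> p) (map_poly \<chi> q)"
proof (induction p)
  case (pCons a p)
  interpret P: partial_hom "{p. \<forall>i. coeff p i \<in> B}" "map_poly \<chi>" by (rule partial_hom_map_poly)
  have "coeff (pCons a p) 0 \<in> B" "coeff (pCons a p) (Suc i) \<in> B" for i
    using pCons.prems(1) by blast+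
  then have ap: "a \<in> B" "p \<in> {p. \<forall>i. coeff p i \<in> B}" by auto
  have "map_poly \<chi> (pcompose (pCons a p) q) = map_poly \<chi> [:a:] + map_poly \<chi> (q * pcompose p q)"
    unfolding pcompose_pCons
    by (rule P.hom_add) (intro P.mult_mem const_mem_polys pcompose_mem_polys ap pCons.prems)+
  also have "map_poly \<chi> (q * pcompose p q) = map_poly \<chi> q * map_poly \<chi> (pcompose p q)"
    by (rule P.hom_mult) (intro pcompose_mem_polys ap pCons.prems)+
  finally show ?case
    using pCons.IH[OF ap(2) pCons.prems(2)]
    by (simp add: pcompose_pCons map_poly_pCons hom_zero)
qed simp

text \<open>
  A Galois extension with group \<open>G\<close> given by a generator \<open>x \<one>\<close> whose conjugates \<open>x g\<close> are distinct.
\<close>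

locale regular_orbit = group G + field_action M "carrier G" act
  for G :: "('g, 'b) monoid_scheme" (structure) and M :: "'a::field set"
    and act :: "'g \<Rightarrow> 'a \<Rightarrow> 'a" +
  fixes x :: "'g \<Rightarrow> 'a"
  assumes finite_G: "finite (carrier G)"
    and x_mem: "g \<in> carrier G \<Longrightarrow> x g \<in> M"
    and inj_x: "inj_on x (carrier G)"
    and act_x: "h \<in> carrier G \<Longrightarrow> g \<in> carrier G \<Longrightarrow> act h (x g) = x (h \<otimes> g)"
begin

text \<open>
  Lagrange interpolation at the points \<open>x g\<close>. The action permutes the summands \<open>L s\<close> as left translation permutes
  their indices, so the sum has invariant coefficients.
\<close>

lemma equivariant_interpolation:
  assumes y_mem: "\<And>g. g \<in> carrier G \<Longrightarrow> y g \<in> M"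
    and act_y: "\<And>h g. h \<in> carrier G \<Longrightarrow> g \<in> carrier G \<Longrightarrow> act h (y g) = y (h \<otimes> g)"
  shows "\<exists>p\<in>polys_over fixed. \<forall>g\<in>carrier G. poly p (x g) = y g"
proof -
  interpret P: subring_set "{p. \<forall>i. coeff p i \<in> M}" by (rule subring_set_polys)
  define R where "R s = root_poly (x ` (carrier G - {s}))" for s
  define L where "L s = smult (y s * inverse (poly (R s) (x s))) (R s)" for s
  have R_mem: "R s \<in> {p. \<forall>i. coeff p i \<in> M}" for s
    unfolding R_def root_poly_def
    by (rule P.prod_mem, rule linear_mem_polys) (auto intro: uminus_mem one_mem x_mem)
  have L_mem: "L s \<in> {p. \<forall>i. coeff p i \<in> M}" if "s \<in> carrier G" for s
    unfolding L_def
    by (intro smult_mem_polys mult_mem inverse_mem poly_mem R_mem x_mem y_mem that)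
  have R_act: "map_poly (act h) (R s) = R (h \<otimes> s)" if hs: "h \<in> carrier G" "s \<in> carrier G" for h s
  proof -
    have inj: "inj_on (act h) (x ` (carrier G - {s}))"
      by (rule inj_on_subset[OF partial_hom_inj_on[OF act_hom[OF hs(1)] inverse_mem]])
        (auto intro: x_mem)
    have "(\<lambda>g. h \<otimes> g) ` (carrier G - {s}) = carrier G - {h \<otimes> s}"
    proof -
      have "g \<in> (\<lambda>g. h \<otimes> g) ` (carrier G - {s})" if "g \<in> carrier G" "g \<noteq> h \<otimes> s" for g
      proof
        show "g = h \<otimes> (inv h \<otimes> g)" using that hs by (simp add: m_assoc[symmetric])
        then show "inv h \<otimes> g \<in> carrier G - {s}" using that hs by auto
      qed
      then show ?thesis using hs by auto
    qed
    moreover have "act h ` x ` (carrier G - {s}) = x ` (\<lambda>g. h \<otimes> g) ` (carrier G - {s})"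
      unfolding image_image by (rule image_cong) (use hs act_x in auto)
    ultimately show ?thesis
      unfolding R_def using map_poly_root_poly[OF act_hom[OF hs(1)] _ inj] x_mem by auto
  qed
  have L_act: "map_poly (act h) (L s) = L (h \<otimes> s)" if hs: "h \<in> carrier G" "s \<in> carrier G" for h s
  proof -
    interpret A: partial_hom M "act h" by (rule act_hom[OF hs(1)])
    have mem: "poly (R s) (x s) \<in> M" by (rule poly_mem[OF R_mem x_mem[OF hs(2)]])
    have "act h (poly (R s) (x s)) = poly (R (h \<otimes> s)) (x (h \<otimes> s))"
      using A.hom_poly[OF R_mem x_mem[OF hs(2)]] by (simp add: R_act hs act_x)
    then have "act h (y s * inverse (poly (R s) (x s)))
        = y (h \<otimes> s) * inverse (poly (R (h \<otimes> s)) (x (h \<otimes> s)))"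
      by (simp add: A.hom_mult y_mem hs inverse_mem mem act_y act_inverse)
    then show ?thesis
      unfolding L_def
      using A.map_poly_smult_partial[OF mult_mem[OF y_mem[OF hs(2)] inverse_mem[OF mem]] R_mem]
      by (simp add: R_act hs)
  qed
  have "map_poly (act h) (\<Sum>s\<in>carrier G. L s) = (\<Sum>s\<in>carrier G. L s)" if h: "h \<in> carrier G" for h
  proof -
    interpret A: partial_hom "{p. \<forall>i. coeff p i \<in> M}" "map_poly (act h)"
      by (rule partial_hom.partial_hom_map_poly[OF act_hom[OF h]])
    have "map_poly (act h) (\<Sum>s\<in>carrier G. L s) = (\<Sum>s\<in>carrier G. L (h \<otimes> s))"
      using h by (simp only: A.hom_sum[OF L_mem] L_act cong: sum.cong)
    also have "\<dots> = (\<Sum>s\<in>carrier G. L s)"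
      by (rule sum.reindex_bij_witness[of _ "\<lambda>s. inv h \<otimes> s" "\<lambda>s. h \<otimes> s"])
        (use h in \<open>simp_all add: m_assoc[symmetric]\<close>)
    finally show ?thesis .
  qed
  moreover have "(\<Sum>s\<in>carrier G. L s) \<in> polys_over M"
    unfolding polys_over_def by (rule P.sum_mem[OF L_mem])
  ultimately have "(\<Sum>s\<in>carrier G. L s) \<in> polys_over fixed"
    by (simp only: polys_over_fixed_iff) blast
  moreover have "poly (\<Sum>s\<in>carrier G. L s) (x g) = y g" if g: "g \<in> carrier G" for g
  proof -
    have root: "poly (R s) (x g) = 0 \<longleftrightarrow> g \<noteq> s" if "s \<in> carrier G" for s
      using that g inj_x by (auto simp: R_def poly_root_poly_eq_0 finite_G dest: inj_onD)
    have "poly (\<Sum>s\<in>carrier G. L s) (x g) = (\<Sum>s\<in>carrier G. if s = g then y g else 0)"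
      unfolding poly_sum
      by (rule sum.cong[OF refl]) (use root g in \<open>auto simp: L_def\<close>)
    then show ?thesis using g finite_G by simp
  qed
  ultimately show ?thesis by blast
qed

definition orbit_poly :: "'a poly" where
  "orbit_poly = root_poly (x ` carrier G)"

lemma orbit:
  shows "finite (x ` carrier G)" "x ` carrier G \<subseteq> M" "x ` carrier G \<noteq> {}"
    and "h \<in> carrier G \<Longrightarrow> act h ` x ` carrier G \<subseteq> x ` carrier G"
    and "u \<in> x ` carrier G \<Longrightarrow> v \<in> x ` carrier G \<Longrightarrow> \<exists>h\<in>carrier G. act h u = v"
proof -
  assume "u \<in> x ` carrier G" "v \<in> x ` carrier G"
  then obtain g h where gh: "g \<in> carrier G" "h \<in> carrier G" "u = x g" "v = x h" by blast
  then have "act (h \<otimes> inv g) u = v" by (simp add: act_x m_assoc)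
  then show "\<exists>h\<in>carrier G. act h u = v" using gh by (intro bexI[of _ "h \<otimes> inv g"]) auto
qed (use finite_G x_mem one_closed in \<open>auto simp: act_x\<close>)

lemma orbit_poly_irreducible: "irreducible_over fixed orbit_poly"
  unfolding orbit_poly_def by (rule root_poly_irreducible[OF orbit(1-3)]) (fact orbit(4) orbit(5))+

lemma orbit_poly_mem: "orbit_poly \<in> polys_over fixed"
  using orbit_poly_irreducible by (simp add: irreducible_over_def)

lemma orbit_poly_simps:
  "lead_coeff orbit_poly = 1" "degree orbit_poly = card (carrier G)" "orbit_poly \<noteq> 0"
  "g \<in> carrier G \<Longrightarrow> poly orbit_poly (x g) = 0"
  unfolding orbit_poly_def
  by (rule lead_coeff_root_poly)
    (simp_all add: degree_root_poly card_image inj_x root_poly_nonzero poly_root_poly_eq_0 finite_G)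

text \<open>
  Polynomial relations that hold at \<open>x \<one>\<close> are multiples of the orbit polynomial, even over \<open>B\<close> since
  it is monic. So they hold at every root of its image under \<open>\<chi>\<close>.
\<close>

lemma vanishing_specializes:
  fixes \<chi> :: "'a \<Rightarrow> 'c::field"
  assumes B: "partial_hom B \<chi>" "B \<subseteq> fixed" "orbit_poly \<in> polys_over B"
    and z: "poly (map_poly \<chi> orbit_poly) z = 0"
    and p: "p \<in> polys_over B" "poly p (x \<one>) = 0"
  shows "poly (map_poly \<chi> p) z = 0"
proof -
  interpret B: partial_hom B \<chi> by fact
  interpret P: partial_hom "{p. \<forall>i. coeff p i \<in> B}" "map_poly \<chi>" by (rule B.partial_hom_map_poly)
  obtain q s where qs: "q \<in> polys_over B" "s \<in> polys_over B" "p = orbit_poly * q + s"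
      "s = 0 \<or> degree s < degree orbit_poly"
    using B.monic_division[of orbit_poly p] B(3) p(1) orbit_poly_simps(1)
    unfolding polys_over_def by blast
  have "poly s (x \<one>) = 0" using p(2) qs(3) orbit_poly_simps(4)[of \<one>] by simp
  moreover have "s \<in> polys_over fixed" using qs(2) B(2) by (auto simp: polys_over_def)
  ultimately have "orbit_poly dvd s"
    unfolding orbit_poly_def
    by (intro root_poly_dvd_fixed[OF orbit(1,2) _ orbit(5)]) simp_all
  then have "s = 0" using qs(4) dvd_imp_degree_le[of orbit_poly s] by fastforce
  then have "map_poly \<chi> p = map_poly \<chi> orbit_poly * map_poly \<chi> q"
    using qs(1,3) B(3) by (simp add: P.hom_mult polys_over_def)
  then show ?thesis using z by simp
qed

text \<open>
  The finite set \<open>E\<close> consists of the coefficients of the orbit polynomial, of polynomials \<open>P g\<close> with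
  \<open>P g (x h) = x (h \<otimes> g)\<close>, and of polynomials \<open>W g g'\<close> whose value at \<open>x h\<close> is the inverse of
  \<open>x (h \<otimes> g) - x (h \<otimes> g')\<close>. Relations between these are preserved by \<open>\<chi>\<close>; those for \<open>W\<close> keep the roots
  distinct, which irreducibility of the image would not do in positive characteristic.
\<close>

lemma orbit_specialization:
  "\<exists>E. finite E \<and> E \<subseteq> fixed \<and>
     (\<forall>B (\<chi> :: 'a \<Rightarrow> 'c::field) z. partial_hom B \<chi> \<and> E \<subseteq> B \<and> B \<subseteq> fixed \<and>
        poly (map_poly \<chi> orbit_poly) z = 0 \<longrightarrow>
        (\<exists>r. inj_on r (carrier G) \<and> map_poly \<chi> orbit_poly = root_poly (r ` carrier G) \<and>
           (\<forall>g\<in>carrier G. \<exists>P\<in>polys_over B. \<forall>h\<in>carrier G. poly (map_poly \<chi> P) (r h) = r (h \<otimes> g))))"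
proof -
  have "\<exists>p\<in>polys_over fixed. \<forall>h\<in>carrier G. poly p (x h) = x (h \<otimes> g)" if g: "g \<in> carrier G" for g
    by (rule equivariant_interpolation) (use g in \<open>auto simp: x_mem act_x m_assoc\<close>)
  then obtain P where P: "\<And>g. g \<in> carrier G \<Longrightarrow> P g \<in> polys_over fixed"
    "\<And>g h. g \<in> carrier G \<Longrightarrow> h \<in> carrier G \<Longrightarrow> poly (P g) (x h) = x (h \<otimes> g)"
    by metis
  have W_ex: "\<exists>p\<in>polys_over fixed. \<forall>h\<in>carrier G. poly p (x h) = inverse (x (h \<otimes> g) - x (h \<otimes> g'))"
    if g: "g \<in> carrier G" "g' \<in> carrier G" for g g'
  proof (rule equivariant_interpolation)
    fix h s assume "h \<in> carrier G" "s \<in> carrier G"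
    then show "act h (inverse (x (s \<otimes> g) - x (s \<otimes> g')))
      = inverse (x (h \<otimes> s \<otimes> g) - x (h \<otimes> s \<otimes> g'))"
      using g partial_hom.hom_diff[OF act_hom]
      by (simp add: act_inverse x_mem diff_mem act_x m_assoc)
  qed (use g in \<open>auto intro!: inverse_mem diff_mem x_mem\<close>)
  define W where "W g g' = (SOME p. p \<in> polys_over fixed \<and>
    (\<forall>h\<in>carrier G. poly p (x h) = inverse (x (h \<otimes> g) - x (h \<otimes> g'))))" for g g'
  have W_some: "W g g' \<in> polys_over fixed \<and>
    (\<forall>h\<in>carrier G. poly (W g g') (x h) = inverse (x (h \<otimes> g) - x (h \<otimes> g')))"
    if "g \<in> carrier G" "g' \<in> carrier G" for g g'
    unfolding W_def by (rule someI_ex) (use W_ex[OF that] in \<open>simp only: Bex_def\<close>)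
  have W: "\<And>g g'. g \<in> carrier G \<Longrightarrow> g' \<in> carrier G \<Longrightarrow> W g g' \<in> polys_over fixed"
    "\<And>g g' h. g \<in> carrier G \<Longrightarrow> g' \<in> carrier G \<Longrightarrow> h \<in> carrier G \<Longrightarrow>
      poly (W g g') (x h) = inverse (x (h \<otimes> g) - x (h \<otimes> g'))"
    using W_some by blast+
  define E where "E = set (coeffs orbit_poly) \<union> (\<Union>g\<in>carrier G. set (coeffs (P g)))
    \<union> (\<Union>g\<in>carrier G. \<Union>g'\<in>carrier G. set (coeffs (W g g')))"
  have coeffs_fixed: "set (coeffs p) \<subseteq> fixed" if "p \<in> polys_over fixed" for p
    using that by (auto simp: polys_over_def coeffs_def)
  have finite_E: "finite E" by (simp add: E_def finite_G)
  have E_fixed: "E \<subseteq> fixed"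
    unfolding E_def by (intro Un_least UN_least coeffs_fixed orbit_poly_mem P(1) W(1))
  have main: "\<exists>r. inj_on r (carrier G) \<and> map_poly \<chi> orbit_poly = root_poly (r ` carrier G) \<and>
      (\<forall>g\<in>carrier G. \<exists>P\<in>polys_over B. \<forall>h\<in>carrier G. poly (map_poly \<chi> P) (r h) = r (h \<otimes> g))"
    if \<chi>: "partial_hom B \<chi>" and EB: "E \<subseteq> B" and BF: "B \<subseteq> fixed"
      and z: "poly (map_poly \<chi> orbit_poly) z = 0" for B and \<chi> :: "'a \<Rightarrow> 'c" and z
  proof -
    interpret B: partial_hom B \<chi> by (rule \<chi>)
    interpret Q: partial_hom "{p. \<forall>i. coeff p i \<in> B}" "map_poly \<chi>" by (rule B.partial_hom_map_poly)
    have in_B: "p \<in> polys_over B" if p: "set (coeffs p) \<subseteq> B" for p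
    proof -
      have "coeff p i \<in> B" for i
      proof -
        have "coeff p i \<in> insert 0 (set (coeffs p))"
          by (simp flip: range_coeff)
        then show ?thesis using p B.zero_mem by auto
      qed
      then show ?thesis by (simp add: polys_over_def)
    qed
    have mem: "orbit_poly \<in> polys_over B" "\<And>g. g \<in> carrier G \<Longrightarrow> P g \<in> polys_over B"
      "\<And>g g'. g \<in> carrier G \<Longrightarrow> g' \<in> carrier G \<Longrightarrow> W g g' \<in> polys_over B"
      using EB in_B by (simp_all only: E_def Un_subset_iff UN_subset_iff)
    note mem' = mem[unfolded polys_over_def]
    define r where "r g = poly (map_poly \<chi> (P g)) z" for g
    note vanish = vanishing_specializes[OF \<chi> BF mem(1) z, unfolded polys_over_def]
    have root: "poly (map_poly \<chi> orbit_poly) (r g) = 0" if g: "g \<in> carrier G" for g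
    proof -
      have "poly (map_poly \<chi> (pcompose orbit_poly (P g))) z = 0"
        by (rule vanish) (use g P(2)[of g \<one>] orbit_poly_simps(4)[of g]
            B.pcompose_mem_polys[OF mem'(1) mem'(2)[OF g]] in \<open>simp_all add: poly_pcompose\<close>)
      then show ?thesis
        by (simp only: B.map_poly_pcompose[OF mem'(1) mem'(2)[OF g]] poly_pcompose r_def)
    qed
    have translate: "poly (map_poly \<chi> (P g)) (r h) = r (h \<otimes> g)"
      if gh: "g \<in> carrier G" "h \<in> carrier G" for g h
    proof -
      let ?p = "pcompose (P g) (P h)"
      have hg: "h \<otimes> g \<in> carrier G" using gh by simp
      have p: "?p \<in> {p. \<forall>i. coeff p i \<in> B}"
        by (rule B.pcompose_mem_polys[OF mem'(2)[OF gh(1)] mem'(2)[OF gh(2)]])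
      have "poly (map_poly \<chi> (?p - P (h \<otimes> g))) z = 0"
        by (rule vanish) (use gh P(2) Q.diff_mem[OF p mem'(2)[OF hg]] in \<open>simp_all add: poly_pcompose\<close>)
      then show ?thesis
        by (simp add: Q.hom_diff[OF p mem'(2)[OF hg]] r_def poly_pcompose
            B.map_poly_pcompose[OF mem'(2)[OF gh(1)] mem'(2)[OF gh(2)]])
    qed
    have inj: "inj_on r (carrier G)"
    proof (rule inj_onI, rule ccontr)
      fix g g' assume g: "g \<in> carrier G" "g' \<in> carrier G" "r g = r g'" "g \<noteq> g'"
      have "x g - x g' \<noteq> 0" using g inj_x by (auto dest: inj_onD)
      note m = mem'(3)[OF g(1,2)] Q.diff_mem[OF mem'(2)[OF g(1)] mem'(2)[OF g(2)]]
      have "poly (map_poly \<chi> (W g g' * (P g - P g') - 1)) z = 0"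
      proof (rule vanish)
        show "W g g' * (P g - P g') - 1 \<in> {p. \<forall>i. coeff p i \<in> B}"
          by (intro Q.diff_mem Q.mult_mem Q.one_mem m)
        show "poly (W g g' * (P g - P g') - 1) (x \<one>) = 0"
          using g P(2) W(2) \<open>x g - x g' \<noteq> 0\<close> by simp
      qed
      moreover have "map_poly \<chi> (W g g' * (P g - P g') - 1)
          = map_poly \<chi> (W g g') * (map_poly \<chi> (P g) - map_poly \<chi> (P g')) - 1"
        using m mem'(2)[OF g(1)] mem'(2)[OF g(2)]
        by (simp only: Q.hom_diff Q.hom_mult Q.hom_one Q.mult_mem Q.one_mem)
      ultimately show False using g(3) by (simp add: r_def)
    qed
    have lc: "coeff (map_poly \<chi> orbit_poly) (card (carrier G)) = 1"
      using orbit_poly_simps(1,2) by (simp add: coeff_map_poly B.hom_zero B.hom_one)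
    have deg: "degree (map_poly \<chi> orbit_poly) = card (carrier G)"
      using map_poly_degree_leq[of \<chi> orbit_poly] le_degree[of "map_poly \<chi> orbit_poly" "card (carrier G)"]
        lc orbit_poly_simps(2) by simp
    have "map_poly \<chi> orbit_poly = root_poly (r ` carrier G)"
      by (rule eq_root_poly) (use root lc deg finite_G in \<open>auto simp: card_image inj\<close>)
    then show ?thesis using inj translate mem(2) by (intro exI[of _ r] conjI ballI bexI[of _ "P _"])
  qed
  show ?thesis
    by (intro exI[of _ E] conjI allI impI finite_E E_fixed, elim conjE) (rule main)
qed

end

section \<open>Localization of a homomorphism into a field\<close>

text \<open>
  The localization of \<open>A\<close> at the kernel of \<open>\<chi>\<close>, inside the field. For injective \<open>\<chi>\<close> it is the
  quotient field.
\<close>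

definition local_ring :: "'a::field set \<Rightarrow> ('a \<Rightarrow> 'b::field) \<Rightarrow> 'a set" where
  "local_ring A \<chi> = {a / s | a s. a \<in> A \<and> s \<in> A \<and> \<chi> s \<noteq> 0}"

definition local_hom :: "'a::field set \<Rightarrow> ('a \<Rightarrow> 'b::field) \<Rightarrow> 'a \<Rightarrow> 'b" where
  "local_hom A \<chi> u = (THE v. \<exists>a s. a \<in> A \<and> s \<in> A \<and> \<chi> s \<noteq> 0 \<and> u = a / s \<and> v = \<chi> a / \<chi> s)"

lemma local_hom_divide:
  assumes "partial_hom A \<chi>" "a \<in> A" "s \<in> A" "\<chi> s \<noteq> 0"
  shows "local_hom A \<chi> (a / s) = \<chi> a / \<chi> s"
  unfolding local_hom_def
proof (rule the_equality)
  interpret A: partial_hom A \<chi> by fact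
  show "\<exists>a' s'. a' \<in> A \<and> s' \<in> A \<and> \<chi> s' \<noteq> 0 \<and> a / s = a' / s' \<and> \<chi> a / \<chi> s = \<chi> a' / \<chi> s'"
    using assms by blast
  fix v assume "\<exists>a' s'. a' \<in> A \<and> s' \<in> A \<and> \<chi> s' \<noteq> 0 \<and> a / s = a' / s' \<and> v = \<chi> a' / \<chi> s'"
  then obtain a' s' where *: "a' \<in> A" "s' \<in> A" "\<chi> s' \<noteq> 0" "a / s = a' / s'" "v = \<chi> a' / \<chi> s'"
    by blast
  have "s \<noteq> 0" "s' \<noteq> 0" using assms(4) *(3) A.hom_zero by auto
  then have "a * s' = a' * s" using *(4) by (simp add: frac_eq_eq)
  then have "\<chi> a * \<chi> s' = \<chi> a' * \<chi> s" using A.hom_mult assms * by metis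
  then show "v = \<chi> a / \<chi> s" using * assms by (simp add: frac_eq_eq)
qed

lemma partial_hom_local_hom:
  assumes "partial_hom A \<chi>"
  shows "partial_hom (local_ring A \<chi>) (local_hom A \<chi>)"
proof
  interpret A: partial_hom A \<chi> by fact
  note div = local_hom_divide[OF assms]
  have nz: "s \<noteq> 0" if "\<chi> s \<noteq> 0" for s using that A.hom_zero by auto
  have mem: "a / s \<in> local_ring A \<chi>" if "a \<in> A" "s \<in> A" "\<chi> s \<noteq> 0" for a s
    using that by (auto simp: local_ring_def)
  show "1 \<in> local_ring A \<chi>" using mem[of 1 1] A.one_mem by (simp add: A.hom_one)
  show "local_hom A \<chi> 1 = 1" using div[of 1 1] A.one_mem by (simp add: A.hom_one)
  fix u v assume "u \<in> local_ring A \<chi>" "v \<in> local_ring A \<chi>"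
  then obtain a s b t where *: "a \<in> A" "s \<in> A" "\<chi> s \<noteq> 0" "u = a / s" "b \<in> A" "t \<in> A" "\<chi> t \<noteq> 0" "v = b / t"
    by (auto simp: local_ring_def)
  have eq: "u - v = (a * t - b * s) / (s * t)" "u * v = (a * b) / (s * t)" "u + v = (a * t + b * s) / (s * t)"
    using * nz by (simp_all add: diff_frac_eq add_frac_eq)
  have st: "s * t \<in> A" "\<chi> (s * t) \<noteq> 0" using * by (simp_all add: A.mult_mem A.hom_mult)
  show "u - v \<in> local_ring A \<chi>" "u * v \<in> local_ring A \<chi>"
    unfolding eq by (rule mem; use * st in \<open>simp add: A.mult_mem A.diff_mem\<close>)+
  show "local_hom A \<chi> (u + v) = local_hom A \<chi> u + local_hom A \<chi> v"
  proof -
    have "local_hom A \<chi> (u + v) = (\<chi> a * \<chi> t + \<chi> b * \<chi> s) / (\<chi> s * \<chi> t)"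
      unfolding eq using * st by (simp add: div A.mult_mem A.add_mem A.hom_mult A.hom_add)
    also have "\<dots> = local_hom A \<chi> u + local_hom A \<chi> v"
      using * by (simp add: div add_frac_eq)
    finally show ?thesis .
  qed
  show "local_hom A \<chi> (u * v) = local_hom A \<chi> u * local_hom A \<chi> v"
    unfolding eq using * st by (simp add: div A.mult_mem A.hom_mult)
qed

lemma subring_set_of_type_algebra:
  assumes "subring A (ring_of_type_algebra :: 'a::comm_ring_1 ring)"
  shows "subring_set A"
proof
  let ?R = "ring_of_type_algebra :: 'a ring"
  interpret R: ring ?R by (rule ring_from_type_algebra)
  have R: "carrier ?R = UNIV" "\<one>\<^bsub>?R\<^esub> = 1" "\<zero>\<^bsub>?R\<^esub> = 0"
    "\<And>x y. x \<otimes>\<^bsub>?R\<^esub> y = x * y" "\<And>x y. x \<oplus>\<^bsub>?R\<^esub> y = x + y"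
    by (simp_all add: ring_of_type_algebra_def)
  have minus: "\<ominus>\<^bsub>?R\<^esub> x = - x" for x
    by (rule R.minus_equality) (simp_all add: R)
  note A = subringE[OF assms]
  show "1 \<in> A" using A(3) by (simp add: R)
  show "x * y \<in> A" if "x \<in> A" "y \<in> A" for x y using A(6)[OF that] by (simp add: R)
  show "x - y \<in> A" if "x \<in> A" "y \<in> A" for x y
    using A(7)[OF that(1) A(5)[OF that(2)]] by (simp add: R minus)
qed

section \<open>Polynomials and rational functions in several variables\<close>

lemma subring_set_poly_ring_in: "subring_set (poly_ring_in V :: ('x, 'a::comm_ring_1) mpoly set)"
proof
  show "(1 :: ('x, 'a) mpoly) \<in> poly_ring_in V"
    by (simp add: poly_ring_in_def mpoly_vars_def one_mpoly.rep_eq)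
  fix p q :: "('x, 'a) mpoly" assume pq: "p \<in> poly_ring_in V" "q \<in> poly_ring_in V"
  have "Poly_Mapping.keys (mapping_of (p - q))
      \<subseteq> Poly_Mapping.keys (mapping_of p) \<union> Poly_Mapping.keys (mapping_of q)"
    by (auto simp: minus_mpoly.rep_eq in_keys_iff lookup_minus)
  then show "p - q \<in> poly_ring_in V"
    using pq unfolding poly_ring_in_def mpoly_vars_def by blast
  have "Poly_Mapping.keys m \<subseteq> V" if m: "m \<in> Poly_Mapping.keys (mapping_of (p * q))" for m
  proof -
    obtain a b where ab: "m = a + b" "a \<in> Poly_Mapping.keys (mapping_of p)"
      "b \<in> Poly_Mapping.keys (mapping_of q)"
      using m keys_mult[of "mapping_of p" "mapping_of q"] by (auto simp: times_mpoly.rep_eq)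
    then have "Poly_Mapping.keys a \<subseteq> V" "Poly_Mapping.keys b \<subseteq> V"
      using pq by (auto simp: poly_ring_in_def mpoly_vars_def)
    then show ?thesis using keys_add[of a b] ab(1) by blast
  qed
  then show "p * q \<in> poly_ring_in V" by (auto simp: poly_ring_in_def mpoly_vars_def)
qed

lemma mpoly_Var_mem: "x \<in> V \<Longrightarrow> mpoly_Var x \<in> poly_ring_in V"
  by (simp add: poly_ring_in_def mpoly_vars_def mpoly_Var_def MPoly_inverse)

lemma mpoly_Const_mem: "mpoly_Const c \<in> poly_ring_in V"
  by (simp add: poly_ring_in_def mpoly_vars_def mpoly_Const_def MPoly_inverse)

lemma poly_ring_in_mono: "V \<subseteq> W \<Longrightarrow> poly_ring_in V \<subseteq> poly_ring_in W"
  by (auto simp: poly_ring_in_def)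

lemma (in subring_set) mpoly_eval_mem:
  assumes "\<And>a. c a \<in> B" "\<And>x. x \<in> mpoly_vars p \<Longrightarrow> s x \<in> B"
  shows "mpoly_eval c s p \<in> B"
  unfolding mpoly_eval_def
  by (intro sum_mem mult_mem prod_mem power_mem assms) (auto simp: mpoly_vars_def)

lemma (in partial_hom) hom_mpoly_eval:
  assumes "\<And>a. c a \<in> B" "\<And>x. x \<in> mpoly_vars p \<Longrightarrow> s x \<in> B"
  shows "\<chi> (mpoly_eval c s p) = mpoly_eval (\<lambda>a. \<chi> (c a)) (\<lambda>x. \<chi> (s x)) p"
proof -
  let ?p = "mapping_of p"
  have s: "s x \<in> B" if "m \<in> Poly_Mapping.keys ?p" "x \<in> Poly_Mapping.keys m" for m x
    using assms(2) that by (auto simp: mpoly_vars_def)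
  have pr: "(\<Prod>x\<in>Poly_Mapping.keys m. s x ^ Poly_Mapping.lookup m x) \<in> B"
    if "m \<in> Poly_Mapping.keys ?p" for m
    by (intro prod_mem power_mem s[OF that])
  have "\<chi> (\<Prod>x\<in>Poly_Mapping.keys m. s x ^ Poly_Mapping.lookup m x)
      = (\<Prod>x\<in>Poly_Mapping.keys m. \<chi> (s x) ^ Poly_Mapping.lookup m x)"
    if "m \<in> Poly_Mapping.keys ?p" for m
    using s[OF that] by (simp add: hom_prod hom_power power_mem)
  then show ?thesis
    unfolding mpoly_eval_def using pr
    by (simp add: hom_sum hom_mult mult_mem assms(1))
qed

lemma Fract_eq_mpoly_eval: "Fract p 1 = mpoly_eval ratfun_Const ratfun_Var p"
proof -
  have "Fract (mpoly_eval mpoly_Const mpoly_Var p) 1 = mpoly_eval ratfun_Const ratfun_Var p"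
    by (rule mpoly_eval_comp[OF unital_ring_hom_Fract]) (simp_all add: ratfun_Const_def ratfun_Var_def)
  then show ?thesis by (simp add: mpoly_sum_monomials)
qed

lemma Fract_divide: "q \<noteq> 0 \<Longrightarrow> Fract p 1 / Fract q 1 = Fract p q"
  by simp

text \<open>
  Evaluation at the point \<open>s\<close> with values in an extension field is defined on the local ring of this point. With
  a generic point \<open>s\<close>, such as one that lists the variables in another order, this local ring is
  the whole rational function field.
\<close>

lemma ratfun_evaluation:
  fixes c :: "'k::field \<Rightarrow> 'b::field" and s :: "'x \<Rightarrow> 'b"
  assumes "unital_ring_hom c"
  shows "\<exists>f. partial_hom {Fract p q | p q. p \<in> poly_ring_in V \<and> q \<in> poly_ring_in V \<and>
        mpoly_eval c s q \<noteq> 0} f \<and>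
      (\<forall>p\<in>poly_ring_in V. \<forall>q\<in>poly_ring_in V. mpoly_eval c s q \<noteq> 0 \<longrightarrow>
        f (Fract p q) = mpoly_eval c s p / mpoly_eval c s q)"
proof -
  let ?e = "mpoly_eval c s"
  interpret V: subring_set "poly_ring_in V :: ('x, 'k) mpoly set" by (rule subring_set_poly_ring_in)
  define A where "A = (\<lambda>p :: ('x, 'k) mpoly. Fract p 1) ` poly_ring_in V"
  define \<chi> where "\<chi> u = ?e (THE p. u = Fract p 1)" for u
  have \<chi>: "\<chi> (Fract p 1) = ?e p" for p
  proof -
    have "(THE p'. Fract p 1 = Fract p' 1) = p"
      by (rule the_equality) (simp_all add: eq_fract)
    then show ?thesis by (simp add: \<chi>_def)
  qed
  have hA: "partial_hom A \<chi>"
  proof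
    show "1 \<in> A" using V.one_mem by (auto simp: A_def One_fract_def)
    show "\<chi> 1 = 1" by (simp add: One_fract_def \<chi> mpoly_eval_1 assms)
    fix u v assume "u \<in> A" "v \<in> A"
    then obtain p q where pq: "p \<in> poly_ring_in V" "u = Fract p 1" "q \<in> poly_ring_in V" "v = Fract q 1"
      by (auto simp: A_def)
    have eq: "u - v = Fract (p - q) 1" "u * v = Fract (p * q) 1" "u + v = Fract (p + q) 1"
      using pq by simp_all
    show "u - v \<in> A" "u * v \<in> A"
      using pq V.diff_mem V.mult_mem unfolding eq A_def by blast+
    show "\<chi> (u + v) = \<chi> u + \<chi> v" "\<chi> (u * v) = \<chi> u * \<chi> v"
      unfolding eq unfolding pq(2,4) \<chi> by (simp_all add: mpoly_eval_add mpoly_eval_mult assms)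
  qed
  have nz: "q \<noteq> 0" if "?e q \<noteq> 0" for q
    using that unital_ring_hom.hom_0[OF mpoly_eval_hom[OF assms]] by auto
  have "local_ring A \<chi> = {Fract p q | p q. p \<in> poly_ring_in V \<and> q \<in> poly_ring_in V \<and> ?e q \<noteq> 0}"
    (is "?L = ?R")
  proof
    show "?L \<subseteq> ?R"
    proof
      fix u assume "u \<in> ?L"
      then obtain p q where "p \<in> poly_ring_in V" "q \<in> poly_ring_in V" "?e q \<noteq> 0" "u = Fract p 1 / Fract q 1"
        by (auto simp: local_ring_def A_def \<chi>)
      then show "u \<in> ?R" using Fract_divide[of q p] nz[of q] by auto
    qed
    show "?R \<subseteq> ?L"
    proof
      fix u assume "u \<in> ?R"
      then obtain p q where pq: "p \<in> poly_ring_in V" "q \<in> poly_ring_in V" "?e q \<noteq> 0" "u = Fract p q"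
        by auto
      then have "u = Fract p 1 / Fract q 1" using Fract_divide[of q p] nz[of q] by simp
      moreover have "Fract p 1 \<in> A" "Fract q 1 \<in> A" "\<chi> (Fract q 1) \<noteq> 0"
        using pq by (simp_all add: A_def \<chi>)
      ultimately show "u \<in> ?L" unfolding local_ring_def by blast
    qed
  qed
  moreover have "local_hom A \<chi> (Fract p q) = ?e p / ?e q"
    if "p \<in> poly_ring_in V" "q \<in> poly_ring_in V" "?e q \<noteq> 0" for p q
    using local_hom_divide[OF hA, of "Fract p 1" "Fract q 1"] that nz[of q]
    by (simp add: A_def \<chi> Fract_divide)
  ultimately show ?thesis using partial_hom_local_hom[OF hA] by auto
qed

lemma ratfun_in_subfield:
  shows "subring_set (ratfun_in V :: ('x, 'k::field) mpoly fract set)"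
    and "u \<in> ratfun_in V \<Longrightarrow> inverse u \<in> (ratfun_in V :: ('x, 'k) mpoly fract set)"
proof -
  have "mpoly_eval ratfun_Const ratfun_Var q = 0 \<longleftrightarrow> q = 0" for q :: "('x, 'k) mpoly"
    by (simp add: Zero_fract_def eq_fract flip: Fract_eq_mpoly_eval)
  then have eq: "{Fract p q | p q. p \<in> poly_ring_in V \<and> q \<in> poly_ring_in V \<and>
      mpoly_eval ratfun_Const ratfun_Var q \<noteq> 0} = (ratfun_in V :: ('x, 'k) mpoly fract set)"
    unfolding ratfun_in_def by simp
  obtain f :: "_ \<Rightarrow> ('x, 'k) mpoly fract"
    where "partial_hom (ratfun_in V :: ('x, 'k) mpoly fract set) f"
    using ratfun_evaluation[OF unital_ring_hom_ratfun_Const, of V "ratfun_Var :: 'x \<Rightarrow> ('x, 'k) mpoly fract"]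
    unfolding eq by blast
  then show "subring_set (ratfun_in V :: ('x, 'k) mpoly fract set)"
    by (auto simp: partial_hom_def)
  assume "u \<in> ratfun_in V"
  then obtain p q where pq: "p \<in> poly_ring_in V" "q \<in> poly_ring_in V" "q \<noteq> 0" "u = Fract p q"
    by (auto simp: ratfun_in_def)
  show "inverse u \<in> ratfun_in V"
  proof (cases "p = 0")
    case True
    then have "inverse u = u" using pq by (simp add: fract_collapse)
    then show ?thesis using \<open>u \<in> ratfun_in V\<close> by simp
  next
    case False
    then show ?thesis using pq by (auto simp: ratfun_in_def)
  qed
qed

section \<open>The permutation action on the rational function field\<close>

lemma partial_hom_ratfun_act:
  assumes "group G" "h \<in> carrier G"
  shows "partial_hom (ratfun_in (carrier G)) (ratfun_act G h :: ('g, 'k::field) mpoly fract \<Rightarrow> _)"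
proof -
  let ?V = "carrier G"
  let ?e = "mpoly_eval ratfun_Const (\<lambda>g. ratfun_Var (h \<otimes>\<^bsub>G\<^esub> g)) :: ('g, 'k) mpoly \<Rightarrow> ('g, 'k) mpoly fract"
  have nz: "?e q \<noteq> 0 \<longleftrightarrow> q \<noteq> 0" if "q \<in> poly_ring_in ?V" for q
    using ratfun_subst_inj[OF assms that]
      unital_ring_hom.hom_0[OF mpoly_eval_hom[OF unital_ring_hom_ratfun_Const]] by blast
  then have eq: "{Fract p q | p q. p \<in> poly_ring_in ?V \<and> q \<in> poly_ring_in ?V \<and> ?e q \<noteq> 0} = ratfun_in ?V"
    unfolding ratfun_in_def by (intro Collect_cong ex_cong1) blast
  obtain f where f: "partial_hom (ratfun_in ?V) f"
    "\<forall>p\<in>poly_ring_in ?V. \<forall>q\<in>poly_ring_in ?V. ?e q \<noteq> 0 \<longrightarrow> f (Fract p q) = ?e p / ?e q"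
    using ratfun_evaluation[OF unital_ring_hom_ratfun_Const, of ?V
        "\<lambda>g. ratfun_Var (h \<otimes>\<^bsub>G\<^esub> g) :: ('g, 'k) mpoly fract"]
    unfolding eq by (elim exE conjE) (rule that)
  show ?thesis
  proof (rule partial_hom_cong[OF f(1)])
    fix u :: "('g, 'k) mpoly fract" assume "u \<in> ratfun_in ?V"
    then obtain p q where "p \<in> poly_ring_in ?V" "q \<in> poly_ring_in ?V" "q \<noteq> 0" "u = Fract p q"
      by (auto simp: ratfun_in_def)
    then show "ratfun_act G h u = f u"
      using ratfun_act_Fract[OF assms, of p q] f(2) nz[of q] by simp
  qed
qed

lemma inj_ratfun_Var: "inj (ratfun_Var :: 'x \<Rightarrow> ('x, 'k::field) mpoly fract)"
proof (rule injI)
  fix x y :: 'x assume "(ratfun_Var x :: ('x, 'k) mpoly fract) = ratfun_Var y"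
  then have "(mpoly_Var x :: ('x, 'k) mpoly) = mpoly_Var y"
    by (simp add: ratfun_Var_def eq_fract)
  then have "mpoly_vars (mpoly_Var x :: ('x, 'k) mpoly) = mpoly_vars (mpoly_Var y :: ('x, 'k) mpoly)"
    by simp
  then show "x = y" by (simp add: mpoly_vars_def mpoly_Var_def MPoly_inverse)
qed

lemma regular_orbit_ratfun:
  assumes "group G" "finite (carrier G)"
  shows "regular_orbit G (ratfun_in (carrier G) :: ('g, 'k::field) mpoly fract set)
    (ratfun_act G) ratfun_Var"
proof -
  have "field_action (ratfun_in (carrier G) :: ('g, 'k) mpoly fract set) (carrier G) (ratfun_act G)"
    by (intro field_action.intro field_action_axioms.intro ratfun_in_subfield
        partial_hom_ratfun_act[OF assms(1)])
  moreover have "ratfun_Var g \<in> (ratfun_in (carrier G) :: ('g, 'k) mpoly fract set)"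
    if "g \<in> carrier G" for g
    unfolding ratfun_Var_def ratfun_in_def mem_Collect_eq
    by (intro exI[of _ "mpoly_Var g"] exI[of _ 1] conjI refl mpoly_Var_mem that zero_neq_one[symmetric]
        subring_set.one_mem[OF subring_set_poly_ring_in])
  moreover have "inj_on (ratfun_Var :: 'g \<Rightarrow> ('g, 'k) mpoly fract) (carrier G)"
    by (rule inj_on_subset[OF inj_ratfun_Var subset_UNIV])
  ultimately show ?thesis
    by (intro regular_orbit.intro regular_orbit_axioms.intro assms ratfun_act_Var[OF assms(1)])
qed

lemma fixed_ratfun_act:
  assumes "group G" "finite (carrier G)"
  shows "field_action.fixed (ratfun_in (carrier G)) (carrier G) (ratfun_act G)
    = (noether_field G :: ('g, 'k::field) mpoly fract set)"
proof -
  interpret regular_orbit G "ratfun_in (carrier G) :: ('g, 'k) mpoly fract set" "ratfun_act G" ratfun_Var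
    by (rule regular_orbit_ratfun[OF assms])
  show ?thesis by (simp add: fixed_def noether_field_def)
qed

section \<open>Retract rational fields embed in rational function fields with a section\<close>

lemma algebra_homD:
  assumes "\<phi> \<in> algebra_hom \<iota> A \<kappa> B" "subring_set A"
  shows "partial_hom A \<phi>" "a \<in> A \<Longrightarrow> \<phi> a \<in> B" "\<phi> (\<iota> c) = \<kappa> c"
proof -
  have \<phi>: "\<phi> \<in> A \<rightarrow> B" "\<phi> 1 = 1" "\<forall>x y. x \<in> A \<and> y \<in> A \<longrightarrow> \<phi> (x * y) = \<phi> x * \<phi> y \<and> \<phi> (x + y) = \<phi> x + \<phi> y"
    using assms(1) unfolding algebra_hom_def ring_hom_def ring_on_simps mem_Collect_eq by blast+
  show "partial_hom A \<phi>"
    using \<phi> assms(2) by (auto intro!: partial_hom.intro partial_hom_axioms.intro)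
  show "a \<in> A \<Longrightarrow> \<phi> a \<in> B" using \<phi>(1) by auto
  show "\<phi> (\<iota> c) = \<kappa> c" using assms(1) by (simp add: algebra_hom_def)
qed

text \<open>
  The embedding \<open>\<phi>\<close> is the extension to quotient fields of the given map from \<open>A\<close> to the localized
  polynomial ring, which is injective since it has a left inverse \<open>\<psi>\<close>. The point \<open>b\<close> has the coordinates \<open>\<psi> (X\<^sub>i)\<close>,
  so \<open>\<psi>\<close> is evaluation at \<open>b\<close>. A nonzero \<open>s \<in> A\<close> satisfies \<open>\<psi> (\<phi> s) = s \<noteq> 0\<close>, so that
  denominators do not vanish at \<open>b\<close>.
\<close>

lemma retract_rational_section:
  fixes \<iota> :: "'k::field \<Rightarrow> 'l::field"
  assumes \<iota>: "unital_ring_hom \<iota>" and L: "retract_rational \<iota> L"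
  shows "\<exists>(n::nat) \<phi> b. partial_hom L \<phi> \<and> range b \<subseteq> L \<and> range \<iota> \<subseteq> L \<and>
    (\<forall>y\<in>L. \<exists>P Q. P \<in> poly_ring_in {..<n} \<and> Q \<in> poly_ring_in {..<n} \<and> mpoly_eval \<iota> b Q \<noteq> 0 \<and>
      \<phi> y = Fract P Q \<and> y = mpoly_eval \<iota> b P / mpoly_eval \<iota> b Q)"
proof -
  obtain A and n :: nat and f \<phi> \<psi> where A: "subalgebra \<iota> A" "A \<subseteq> L" "is_quotient_field_of L A"
    and f: "f \<in> poly_ring_in {..<n}" "f \<noteq> 0"
    and \<phi>: "\<phi> \<in> algebra_hom \<iota> A ratfun_Const (localized_poly_ring {..<n} f)"
    and \<psi>: "\<psi> \<in> algebra_hom ratfun_Const (localized_poly_ring {..<n} f) \<iota> A"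
    and retract: "\<forall>a\<in>A. \<psi> (\<phi> a) = a"
    using L unfolding retract_rational_def by (elim exE conjE) (rule that)
  have \<psi>\<phi>: "\<psi> (\<phi> a) = a" if "a \<in> A" for a
    using retract that by blast
  let ?V = "{..<n}" and ?S = "localized_poly_ring {..<n} f"
  interpret V: subring_set "poly_ring_in ?V :: (nat, 'k) mpoly set" by (rule subring_set_poly_ring_in)
  have S_mem: "Fract p (f ^ m) \<in> ?S" if "p \<in> poly_ring_in ?V" for p m
    using that by (auto simp: localized_poly_ring_def)
  have S_poly: "Fract p 1 \<in> ?S" if "p \<in> poly_ring_in ?V" for p
    using S_mem[OF that, of 0] by simp
  interpret S: subring_set ?S
  proof
    show "1 \<in> ?S" using S_poly[OF V.one_mem] by (simp add: One_fract_def)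
    fix u v assume "u \<in> ?S" "v \<in> ?S"
    then obtain p m q l where pq: "p \<in> poly_ring_in ?V" "u = Fract p (f ^ m)"
      "q \<in> poly_ring_in ?V" "v = Fract q (f ^ l)"
      by (auto simp: localized_poly_ring_def)
    have "u - v = Fract (p * f ^ l - q * f ^ m) (f ^ (m + l))" "u * v = Fract (p * q) (f ^ (m + l))"
      using pq f(2) by (simp_all add: power_add)
    then show "u - v \<in> ?S" "u * v \<in> ?S"
      using pq f(1) by (auto intro!: S_mem V.diff_mem V.mult_mem V.power_mem)
  qed
  have sA: "subring_set A" using A(1) subring_set_of_type_algebra by (auto simp: subalgebra_def)
  note \<phi>_hom = algebra_homD[OF \<phi> sA] and \<psi>_hom = algebra_homD[OF \<psi> S.subring_set_axioms]
  interpret Phi: partial_hom A \<phi> by (rule \<phi>_hom)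
  interpret Psi: partial_hom ?S \<psi> by (rule \<psi>_hom)
  note \<phi>_mem = \<phi>_hom(2) and \<psi>_mem = \<psi>_hom(2) and \<psi>_Const = \<psi>_hom(3)
  \<comment> \<open>The coordinates beyond \<open>n\<close> are arbitrary elements of \<open>L\<close>.\<close>
  define b where "b i = (if i < n then \<psi> (ratfun_Var i) else 0)" for i
  let ?e = "mpoly_eval \<iota> b"
  have Var_S: "ratfun_Var i \<in> ?S" if "i < n" for i
    unfolding ratfun_Var_def by (rule S_poly) (simp add: mpoly_Var_mem that)
  have Const_S: "ratfun_Const c \<in> ?S" for c
    unfolding ratfun_Const_def by (rule S_poly) (simp add: mpoly_Const_mem)
  have \<psi>_poly: "\<psi> (Fract p 1) = ?e p" if p: "p \<in> poly_ring_in ?V" for p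
  proof -
    have vars: "mpoly_vars p \<subseteq> ?V" using p by (simp add: poly_ring_in_def)
    have "\<psi> (Fract p 1) = mpoly_eval (\<lambda>c. \<psi> (ratfun_Const c)) (\<lambda>i. \<psi> (ratfun_Var i)) p"
      unfolding Fract_eq_mpoly_eval
      by (rule Psi.hom_mpoly_eval) (use vars Var_S Const_S in auto)
    also have "\<dots> = ?e p"
      by (rule mpoly_eval_comp[of "\<lambda>x. x"])
        (use vars in \<open>auto simp: \<psi>_Const b_def unital_ring_hom_def\<close>)
    finally show ?thesis .
  qed
  have fb: "?e f \<noteq> 0"
  proof
    assume "?e f = 0"
    have "Fract f 1 * Fract 1 (f ^ 1) = 1" using f(2) by (simp add: One_fract_def eq_fract)
    moreover have "Fract 1 (f ^ 1) \<in> ?S" by (rule S_mem[OF V.one_mem])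
    ultimately have "\<psi> (Fract f 1) * \<psi> (Fract 1 (f ^ 1)) = 1"
      using Psi.hom_mult[OF S_poly[OF f(1)], of "Fract 1 (f ^ 1)"] Psi.hom_one by simp
    then show False using \<open>?e f = 0\<close> \<psi>_poly[OF f(1)] by simp
  qed
  have e_mult: "?e (p * q) = ?e p * ?e q" for p q by (rule mpoly_eval_mult[OF \<iota>])
  have e_power: "?e (p ^ m) = ?e p ^ m" for p m
    by (rule unital_ring_hom_power[OF mpoly_eval_hom[OF \<iota>]])
  have \<phi>_form: "\<exists>p m. p \<in> poly_ring_in ?V \<and> \<phi> a = Fract p (f ^ m) \<and> ?e p = a * ?e f ^ m"
    if a: "a \<in> A" for a
  proof -
    obtain p m where pm: "p \<in> poly_ring_in ?V" "\<phi> a = Fract p (f ^ m)"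
      using \<phi>_mem[OF a] by (auto simp: localized_poly_ring_def)
    have "Fract p 1 = \<phi> a * Fract (f ^ m) 1" using f(2) pm(2) by (simp add: eq_fract)
    then have "\<psi> (Fract p 1) = \<psi> (\<phi> a) * \<psi> (Fract (f ^ m) 1)"
      using Psi.hom_mult[OF \<phi>_mem[OF a] S_poly[OF V.power_mem[OF f(1)]]] by simp
    then have "?e p = a * ?e f ^ m"
      using \<psi>_poly[OF pm(1)] \<psi>_poly[OF V.power_mem[OF f(1)]] \<psi>\<phi>[OF a] e_power by simp
    then show ?thesis using pm by blast
  qed
  have \<phi>_nz: "\<phi> s \<noteq> 0 \<longleftrightarrow> s \<noteq> 0" if "s \<in> A" for s
    using \<psi>\<phi>[OF that] Psi.hom_zero Phi.hom_zero by auto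
  then have "local_ring A \<phi> = {a / b | a b. a \<in> A \<and> b \<in> A \<and> b \<noteq> 0}"
    unfolding local_ring_def by (intro Collect_cong ex_cong1) blast
  then have L_eq: "L = local_ring A \<phi>"
    using A(3) by (simp only: is_quotient_field_of_def)
  have sec: "\<exists>P Q. P \<in> poly_ring_in ?V \<and> Q \<in> poly_ring_in ?V \<and> ?e Q \<noteq> 0 \<and>
      local_hom A \<phi> y = Fract P Q \<and> y = ?e P / ?e Q" if "y \<in> L" for y
  proof -
    obtain a s where as: "a \<in> A" "s \<in> A" "\<phi> s \<noteq> 0" "y = a / s"
      using \<open>y \<in> L\<close> unfolding L_eq by (auto simp: local_ring_def)
    obtain p m where p: "p \<in> poly_ring_in ?V" "\<phi> a = Fract p (f ^ m)" "?e p = a * ?e f ^ m"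
      using \<phi>_form[OF as(1)] by blast
    obtain q l where q: "q \<in> poly_ring_in ?V" "\<phi> s = Fract q (f ^ l)" "?e q = s * ?e f ^ l"
      using \<phi>_form[OF as(2)] by blast
    have "s \<noteq> 0" using as(2,3) \<phi>_nz by blast
    have "local_hom A \<phi> y = Fract (p * f ^ l) (q * f ^ m)"
      using local_hom_divide[OF Phi.partial_hom_axioms as(1-3)] as(4) p(2) q(2)
      by (simp add: mult.commute)
    moreover have "?e (q * f ^ m) \<noteq> 0"
      using q(3) \<open>s \<noteq> 0\<close> fb by (simp add: e_mult e_power)
    moreover have "y = ?e (p * f ^ l) / ?e (q * f ^ m)"
      using as(4) p(3) q(3) fb \<open>s \<noteq> 0\<close> by (simp add: e_mult e_power)
    moreover have "p * f ^ l \<in> poly_ring_in ?V" "q * f ^ m \<in> poly_ring_in ?V"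
      using p(1) q(1) V.mult_mem V.power_mem[OF f(1)] by blast+
    ultimately show ?thesis by (intro exI[of _ "p * f ^ l"] exI[of _ "q * f ^ m"] conjI)
  qed
  have bL: "range b \<subseteq> L"
  proof -
    have "b i \<in> A" for i
      using \<psi>_mem[OF Var_S] subring_set.zero_mem[OF sA] by (simp add: b_def)
    then show ?thesis using A(2) by blast
  qed
  have \<iota>L: "range \<iota> \<subseteq> L" using A(1,2) unfolding subalgebra_def by blast
  have hom: "partial_hom L (local_hom A \<phi>)"
    unfolding L_eq by (rule partial_hom_local_hom[OF Phi.partial_hom_axioms])
  show ?thesis
    by (rule exI[of _ n], rule exI[of _ "local_hom A \<phi>"], rule exI[of _ b])
      (intro conjI ballI hom bL \<iota>L sec)
qed

section \<open>Irreducibility descends from a specialization\<close>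

text \<open>
  The denominators come from a multiplicative set \<open>S\<close>, and so does the common denominator. This is
  needed for \<open>S\<close> the polynomials that do not vanish at a given point.
\<close>

lemma common_denominator:
  fixes u :: "'r::idom fract poly"
  assumes S: "1 \<in> S" "\<And>p q. p \<in> S \<Longrightarrow> q \<in> S \<Longrightarrow> p * q \<in> S" "0 \<notin> S"
    and u: "\<And>i. \<exists>P Q. Q \<in> S \<and> coeff u i = Fract P Q"
  shows "\<exists>D\<in>S. \<exists>U. map_poly to_fract U = smult (to_fract D) u"
  using u
proof (induction u)
  case 0
  then show ?case using S(1) by (intro bexI[of _ 1] exI[of _ 0]) auto
next
  case (pCons c u)
  have "\<exists>P Q. Q \<in> S \<and> coeff u i = Fract P Q" for i
    using pCons.prems[of "Suc i"] by simp
  then obtain D U where D: "D \<in> S" "map_poly to_fract U = smult (to_fract D) u"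
    using pCons.IH by blast
  obtain P Q where Q: "Q \<in> S" "c = Fract P Q" using pCons.prems[of 0] by auto
  have "Q \<noteq> 0" using Q(1) S(3) by auto
  then have "to_fract (P * D) = to_fract (D * Q) * c"
    by (simp add: Q(2) to_fract_def eq_fract mult_ac)
  then have "map_poly to_fract (pCons (P * D) (smult Q U)) = smult (to_fract (D * Q)) (pCons c u)"
    using D(2) by (simp add: map_poly_pCons mult_ac)
  then show ?case using S(2)[OF D(1) Q(1)] by blast
qed

text \<open>
  Here and below the coefficient ring \<open>'a poly\<close> consists of polynomials in a parameter \<open>t\<close>. The highest power of \<open>t\<close>
  that divides \<open>p\<close> is extracted; it exists because each division by \<open>t\<close> lowers the degree in \<open>t\<close> of the
  leading coefficient.
\<close>

lemma lowest_part:
  fixes p :: "'a::idom poly poly"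
  assumes "p \<noteq> 0"
  shows "\<exists>n p'. p = smult ([:0, 1:] ^ n) p' \<and> map_poly (\<lambda>q. poly q 0) p' \<noteq> 0"
  using assms
proof (induction "degree (lead_coeff p)" arbitrary: p rule: less_induct)
  case less
  show ?case
  proof (cases "map_poly (\<lambda>q. poly q 0) p = 0")
    case True
    define p' where "p' = map_poly (poly_shift 1) p"
    have "coeff (coeff p i) 0 = 0" for i
      using True by (simp add: poly_eq_iff coeff_map_poly poly_0_coeff_0)
    then have eq: "p = smult [:0, 1:] p'"
      by (auto simp: p'_def poly_eq_iff coeff_map_poly coeff_pCons coeff_poly_shift
          split: nat.splits)
    then have nz: "p' \<noteq> 0" using less.prems by auto
    have "degree p = degree p'" using eq by simp
    then have "lead_coeff p = [:0, 1:] * lead_coeff p'" using eq by (metis coeff_smult)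
    moreover have "lead_coeff p' \<noteq> 0" using nz by simp
    ultimately have "degree (lead_coeff p') < degree (lead_coeff p)" by simp
    from less.hyps[OF this nz] obtain n p'' where
      "p' = smult ([:0, 1:] ^ n) p''" "map_poly (\<lambda>q. poly q 0) p'' \<noteq> 0" by blast
    then show ?thesis
      using eq by (intro exI[of _ "Suc n"] exI[of _ p'']) simp
  qed (intro exI[of _ 0] exI[of _ p], simp)
qed

lemma partial_hom_eval_0: "partial_hom UNIV (map_poly (\<lambda>q. poly q 0) :: 'a::comm_ring_1 poly poly \<Rightarrow> _)"
proof -
  have "partial_hom UNIV (\<lambda>q :: 'a poly. poly q 0)" by unfold_locales simp_all
  from partial_hom.partial_hom_map_poly[OF this] show ?thesis by simp
qed

lemma smult_left_cancel:
  fixes p q :: "'a::idom poly"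
  shows "smult c p = smult c q \<Longrightarrow> c \<noteq> 0 \<Longrightarrow> p = q"
  by (simp add: poly_eq_iff)

lemma lowest_part_unique:
  fixes A B :: "'a::idom poly poly"
  assumes "smult ([:0, 1:] ^ m) A = smult ([:0, 1:] ^ n) B"
    and "map_poly (\<lambda>q. poly q 0) A \<noteq> 0" "map_poly (\<lambda>q. poly q 0) B \<noteq> 0"
  shows "A = B"
proof -
  have *: "A = B" if "m \<le> n" "smult ([:0, 1:] ^ m) A = smult ([:0, 1:] ^ n) B"
    "map_poly (\<lambda>q. poly q 0) A \<noteq> 0" for m n and A B :: "'a poly poly"
  proof -
    have "[:0, 1:] ^ n = ([:0, 1:] :: 'a poly) ^ m * [:0, 1:] ^ (n - m)"
      unfolding power_add[symmetric] using that(1) by simp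
    then have "smult ([:0, 1:] ^ m) A = smult ([:0, 1:] ^ m) (smult ([:0, 1:] ^ (n - m)) B)"
      unfolding that(2) smult_smult by (rule arg_cong)
    moreover have "([:0, 1:] :: 'a poly) ^ m \<noteq> 0" by simp
    ultimately have eq: "A = smult ([:0, 1:] ^ (n - m)) B"
      by (rule smult_left_cancel)
    have "n - m = 0"
    proof (rule ccontr)
      assume "n - m \<noteq> 0"
      then have "map_poly (\<lambda>q. poly q 0) A = 0"
        unfolding eq by (simp add: poly_eq_iff coeff_map_poly poly_power)
      then show False using that(3) by simp
    qed
    then show ?thesis using eq by simp
  qed
  show ?thesis
  proof (cases "m \<le> n")
    case True
    then show ?thesis using assms(1,2) by (rule *[of m n])
  next
    case False
    then have "n \<le> m" by simp
    from this assms(1)[symmetric] assms(3) have "B = A" by (rule *[of n m])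
    then show ?thesis by simp
  qed
qed

text \<open>
  Let \<open>h\<^sup>\<phi> = u v\<close> over \<open>k(X)\<close>, with denominators \<open>Du\<close> and \<open>Dv\<close>, and let \<open>c\<close> be a point over \<open>k\<close> at which
  neither vanishes. The substitution \<open>E : X\<^sub>i \<mapsto> b\<^sub>i + t (c\<^sub>i - b\<^sub>i)\<close> restricts everything to the
  line from \<open>b\<close> to \<open>c\<close>. The denominators may vanish at \<open>t = 0\<close>, that is at \<open>b\<close>, but not identically, since
  \<open>t = 1\<close> is the point \<open>c\<close>. The restriction of \<open>h\<^sup>\<phi>\<close> is defined at \<open>t = 0\<close> with value \<open>h\<close>. As \<open>t\<close> is prime in
  the polynomial ring, lowest order parts in \<open>t\<close> are multiplicative, so the lowest order parts of the
  two factors multiply to \<open>h\<close> up to a constant, and their degrees do not exceed those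
  of \<open>u\<close> and \<open>v\<close>.
\<close>

lemma irreducible_over_ratfun:
  fixes \<iota> :: "'k::field \<Rightarrow> 'l::field" and \<phi> :: "'l \<Rightarrow> (nat, 'k) mpoly fract"
  assumes \<iota>: "unital_ring_hom \<iota>" "range \<iota> \<subseteq> L" and b: "range b \<subseteq> L"
    and L: "\<And>x. x \<in> L \<Longrightarrow> inverse x \<in> L" and \<phi>: "partial_hom L \<phi>"
    and ret: "\<And>y. y \<in> L \<Longrightarrow> \<exists>P Q. P \<in> poly_ring_in V \<and> Q \<in> poly_ring_in V \<and>
      mpoly_eval \<iota> b Q \<noteq> 0 \<and> \<phi> y = Fract P Q \<and> y = mpoly_eval \<iota> b P / mpoly_eval \<iota> b Q"
    and nonvanishing: "\<And>D :: (nat, 'k) mpoly. D \<in> poly_ring_in V \<Longrightarrow> D \<noteq> 0 \<Longrightarrow> \<exists>c. mpoly_eval (\<lambda>x. x) c D \<noteq> 0"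
    and h: "irreducible_over L h" "lead_coeff h = 1"
  shows "irreducible_over (ratfun_in V) (map_poly \<phi> h)"
proof (rule irreducible_overI[OF ratfun_in_subfield])
  let ?e = "mpoly_eval \<iota> b"
  let ?ev0 = "map_poly (\<lambda>q :: 'l poly. poly q 0)"
  interpret L: partial_hom L \<phi> by fact
  interpret V: subring_set "poly_ring_in V :: (nat, 'k) mpoly set" by (rule subring_set_poly_ring_in)
  interpret e0: partial_hom UNIV ?ev0 by (rule partial_hom_eval_0)
  have e_hom: "unital_ring_hom ?e" by (rule mpoly_eval_hom[OF \<iota>(1)])
  have hL: "coeff h i \<in> L" for i using h(1) by (auto simp: irreducible_over_def polys_over_def)
  have deg_h: "degree (map_poly \<phi> h) = degree h"
    by (rule map_poly_degree_eq) (simp add: h(2) L.hom_one)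
  show "degree (map_poly \<phi> h) > 0"
    unfolding deg_h by (rule degree_irreducible_over[OF h(1) L.subring_set_axioms L])
  have e_nz: "Q \<noteq> 0" if "?e Q \<noteq> 0" for Q
    using that unital_ring_hom.hom_0[OF e_hom] by auto
  have "\<phi> y \<in> ratfun_in V" if "y \<in> L" for y
    using ret[OF that] e_nz unfolding ratfun_in_def by blast
  then show "map_poly \<phi> h \<in> polys_over (ratfun_in V)"
    using hL by (simp add: polys_over_def coeff_map_poly L.hom_zero)
  fix u v
  assume u: "u \<in> polys_over (ratfun_in V)" and v: "v \<in> polys_over (ratfun_in V)"
    and uv: "map_poly \<phi> h = u * v"
  have denom: "\<exists>D U. D \<in> poly_ring_in V \<and> D \<noteq> 0 \<and> map_poly to_fract U = smult (to_fract D) w"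
    if w: "w \<in> polys_over (ratfun_in V)" for w :: "(nat, 'k) mpoly fract poly"
  proof -
    have "\<exists>D\<in>poly_ring_in V - {0}. \<exists>U. map_poly to_fract U = smult (to_fract D) w"
    proof (rule common_denominator)
      fix i
      have "coeff w i \<in> ratfun_in V" using w by (auto simp: polys_over_def)
      then show "\<exists>P Q. Q \<in> poly_ring_in V - {0} \<and> coeff w i = Fract P Q"
        unfolding ratfun_in_def by blast
    qed (auto simp: V.one_mem V.mult_mem)
    then show ?thesis by blast
  qed
  obtain Du U where Du: "Du \<in> poly_ring_in V" "Du \<noteq> 0" "map_poly to_fract U = smult (to_fract Du) u"
    using denom[OF u] by blast
  obtain Dv U' where Dv: "Dv \<in> poly_ring_in V" "Dv \<noteq> 0" "map_poly to_fract U' = smult (to_fract Dv) v"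
    using denom[OF v] by blast
  have "\<exists>D\<in>{Q. ?e Q \<noteq> 0}. \<exists>W. map_poly to_fract W = smult (to_fract D) (map_poly \<phi> h)"
  proof (rule common_denominator)
    show "\<exists>P Q. Q \<in> {Q. ?e Q \<noteq> 0} \<and> coeff (map_poly \<phi> h) i = Fract P Q" for i
      using ret[OF hL[of i]] by (auto simp: coeff_map_poly L.hom_zero)
  qed (use e_hom in \<open>auto simp: unital_ring_hom.hom_1 unital_ring_hom.hom_mult unital_ring_hom.hom_0\<close>)
  then obtain D W where D: "?e D \<noteq> 0" "map_poly to_fract W = smult (to_fract D) (map_poly \<phi> h)"
    by blast
  have W_b: "?e (coeff W i) = ?e D * coeff h i" for i
  proof -
    obtain P Q where PQ: "?e Q \<noteq> 0" "\<phi> (coeff h i) = Fract P Q" "coeff h i = ?e P / ?e Q"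
      using ret[OF hL[of i]] by blast
    have "to_fract (coeff W i) = to_fract D * Fract P Q"
      using arg_cong[OF D(2), of "\<lambda>p. coeff p i"] PQ(2) by (simp add: coeff_map_poly L.hom_zero)
    then have "coeff W i * Q = D * P"
      using e_nz[OF PQ(1)] by (simp add: to_fract_def eq_fract)
    then have "?e (coeff W i) * ?e Q = ?e D * ?e P"
      using unital_ring_hom.hom_mult[OF e_hom] by metis
    then have "?e (coeff W i) = ?e D * ?e P / ?e Q"
      by (simp only: nonzero_eq_divide_eq[OF PQ(1)])
    then show ?thesis using PQ(3) by simp
  qed
  have "map_poly to_fract (smult D (U * U')) = map_poly to_fract (smult (Du * Dv) W)"
    by (simp add: Du(3) Dv(3) D(2) uv mult_ac)
  then have main: "smult D (U * U') = smult (Du * Dv) W" by (simp only: fract_poly_eq_iff)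
  obtain c where c: "mpoly_eval (\<lambda>x. x) c (Du * Dv) \<noteq> 0"
    using nonvanishing[of "Du * Dv"] Du(1,2) Dv(1,2) V.mult_mem by auto
  define E where "E = mpoly_eval (\<lambda>a. [:\<iota> a:]) (\<lambda>i. [:b i, \<iota> (c i) - b i:])"
  have E_hom: "unital_ring_hom E"
    unfolding E_def
    by (rule mpoly_eval_hom) (use \<iota>(1) in \<open>auto simp: unital_ring_hom_def one_pCons\<close>)
  have E_0: "poly (E P) 0 = ?e P" for P
    unfolding E_def by (rule mpoly_eval_comp) (auto simp: unital_ring_hom_def)
  have E_1: "poly (E P) 1 = \<iota> (mpoly_eval (\<lambda>x. x) c P)" for P
  proof -
    have "poly (E P) 1 = mpoly_eval \<iota> (\<lambda>i. \<iota> (c i)) P"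
      unfolding E_def by (rule mpoly_eval_comp) (auto simp: unital_ring_hom_def)
    also have "\<dots> = \<iota> (mpoly_eval (\<lambda>x. x) c P)"
      by (rule mpoly_eval_comp[symmetric]) (use \<iota>(1) in auto)
    finally show ?thesis .
  qed
  have E_L: "coeff (E P) i \<in> L" for P i
  proof -
    interpret PL: subring_set "{p. \<forall>i. coeff p i \<in> L}" by (rule L.subring_set_polys)
    have "E P \<in> {p. \<forall>i. coeff p i \<in> L}"
      unfolding E_def
      by (rule PL.mpoly_eval_mem; intro L.const_mem_polys L.linear_mem_polys L.diff_mem)
        (use \<iota>(2) b in auto)
    then show ?thesis by blast
  qed
  have E_poly: "partial_hom UNIV (map_poly E)"
    using partial_hom.partial_hom_map_poly[OF partial_hom_UNIV[OF E_hom]] by simp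
  interpret E: partial_hom UNIV "map_poly E" by (rule E_poly)
  have E_zero: "E 0 = 0" by (rule unital_ring_hom.hom_0[OF E_hom])
  have E_smult: "map_poly E (smult d p) = smult (E d) (map_poly E p)" for d p
    by (rule poly_eqI) (simp add: coeff_map_poly E_zero unital_ring_hom.hom_mult[OF E_hom])
  have main': "smult (E D) (map_poly E U * map_poly E U') = smult (E (Du * Dv)) (map_poly E W)"
    using arg_cong[OF main, of "map_poly E"] by (simp add: E_smult E.hom_mult)
  have ev0_W: "?ev0 (map_poly E W) = smult (?e D) h"
    by (rule poly_eqI) (simp add: coeff_map_poly E_zero E_0 W_b)
  have "h \<noteq> 0" using h(2) by auto
  have d_nz: "E (Du * Dv) \<noteq> 0"
  proof
    assume "E (Du * Dv) = 0"
    then have "\<iota> (mpoly_eval (\<lambda>x. x) c (Du * Dv)) = 0" using E_1[of "Du * Dv"] by simp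
    then have "\<iota> (mpoly_eval (\<lambda>x. x) c (Du * Dv) * inverse (mpoly_eval (\<lambda>x. x) c (Du * Dv))) = 0"
      by (simp only: unital_ring_hom.hom_mult[OF \<iota>(1)] mult_zero_left)
    then have "\<iota> 1 = 0" by (simp only: right_inverse[OF c])
    then show False by (simp add: unital_ring_hom.hom_1[OF \<iota>(1)])
  qed
  have "map_poly E W \<noteq> 0" using ev0_W D(1) \<open>h \<noteq> 0\<close> by auto
  then have "smult (E D) (map_poly E U * map_poly E U') \<noteq> 0"
    unfolding main' using d_nz by simp
  then have nz: "map_poly E U \<noteq> 0" "map_poly E U' \<noteq> 0" by auto
  obtain \<alpha> A where A: "map_poly E U = smult ([:0, 1:] ^ \<alpha>) A" "?ev0 A \<noteq> 0"
    using lowest_part[OF nz(1)] by blast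
  obtain \<beta> B where B: "map_poly E U' = smult ([:0, 1:] ^ \<beta>) B" "?ev0 B \<noteq> 0"
    using lowest_part[OF nz(2)] by blast
  obtain \<gamma> w where w: "E (Du * Dv) = [:0, 1:] ^ \<gamma> * w" "poly w 0 \<noteq> 0"
    using order_decomp[OF d_nz, of 0] by (auto simp: poly_eq_0_iff_dvd)
  have ev0_smult: "?ev0 (smult d p) = smult (poly d 0) (?ev0 p)" for d p
    by (rule poly_eqI) (simp add: coeff_map_poly)
  have "smult (E D) (A * B) = smult w (map_poly E W)"
  proof (rule lowest_part_unique)
    show "smult ([:0, 1:] ^ (\<alpha> + \<beta>)) (smult (E D) (A * B)) = smult ([:0, 1:] ^ \<gamma>) (smult w (map_poly E W))"
      using main' by (simp add: A(1) B(1) w(1) power_add mult_ac)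
  qed (use A(2) B(2) D(1) w(2) ev0_W \<open>h \<noteq> 0\<close> in \<open>simp_all add: ev0_smult e0.hom_mult E_0\<close>)
  then have "?ev0 (smult (E D) (A * B)) = ?ev0 (smult w (map_poly E W))" by simp
  then have "smult (?e D) (?ev0 A * ?ev0 B) = smult (?e D) (smult (poly w 0) h)"
    by (simp add: ev0_smult e0.hom_mult E_0 ev0_W mult_ac)
  then have XY: "?ev0 A * ?ev0 B = smult (poly w 0) h"
    using D(1) smult_left_cancel by blast
  \<comment> \<open>The lowest order part in \<open>t\<close> collects the coefficients of \<open>t ^ \<alpha>\<close>, which lie in \<open>L\<close> because the coordinates of \<open>b\<close> and the image of \<open>\<iota>\<close> do.\<close>
  have low_L: "?ev0 Z \<in> polys_over L" if "map_poly E U = smult ([:0, 1:] ^ \<alpha>) Z" for U Z \<alpha>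
  proof -
    have "coeff (?ev0 Z) i \<in> L" for i
    proof -
      have "coeff (?ev0 Z) i = coeff (coeff Z i) 0" by (simp add: coeff_map_poly poly_0_coeff_0)
      also have "\<dots> = coeff (Polynomial.monom 1 \<alpha> * coeff Z i) \<alpha>" by (simp add: coeff_monom_mult)
      also have "Polynomial.monom 1 \<alpha> = ([:0, 1:] ^ \<alpha> :: 'l poly)"
        unfolding monom_altdef by (rule smult_1_left)
      also have "[:0, 1:] ^ \<alpha> * coeff Z i = coeff (map_poly E U) i"
        unfolding that by (rule coeff_smult[symmetric])
      also have "\<dots> = E (coeff U i)" by (simp only: coeff_map_poly[where f = E, OF E_zero])
      finally show ?thesis using E_L by simp
    qed
    then show ?thesis by (simp add: polys_over_def)
  qed
  have low_degree: "degree (?ev0 Z) \<le> degree t"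
    if "map_poly E U = smult ([:0, 1:] ^ \<alpha>) Z" "map_poly to_fract U = smult (to_fract d) t" "d \<noteq> 0"
    for U Z \<alpha> d t
  proof -
    have "degree (?ev0 Z) \<le> degree Z" by (rule map_poly_degree_leq)
    also have "\<dots> = degree (map_poly E U)" by (simp add: that(1))
    also have "\<dots> \<le> degree U" by (rule map_poly_degree_leq)
    also have "\<dots> = degree (map_poly to_fract U)" by (simp add: degree_map_poly)
    also have "\<dots> = degree t" by (simp add: that(2,3))
    finally show ?thesis .
  qed
  note memX = low_L[OF A(1)] and memY = low_L[OF B(1)]
  have "coeff (?ev0 A * ?ev0 B) (degree h) \<in> L"
    using subring_set.mult_mem[OF L.subring_set_polys] memX memY by (auto simp: polys_over_def)
  then have "poly w 0 \<in> L" using h(2) by (simp add: XY)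
  then have "smult (inverse (poly w 0)) (?ev0 A) \<in> polys_over L"
    using memX L L.smult_mem_polys by (simp add: polys_over_def)
  moreover have "h = smult (inverse (poly w 0)) (?ev0 A) * ?ev0 B"
    using w(2) by (simp add: XY)
  ultimately have "degree (smult (inverse (poly w 0)) (?ev0 A)) = 0 \<or> degree (?ev0 B) = 0"
    by (rule irreducible_overD[OF h(1) _ memY])
  then have "degree (?ev0 A) = 0 \<or> degree (?ev0 B) = 0" using w(2) by simp
  moreover have "degree (?ev0 A) + degree (?ev0 B) = degree h"
    using arg_cong[OF XY, of degree] A(2) B(2) w(2) by (simp add: degree_mult_eq)
  moreover have "degree h = degree u + degree v"
  proof -
    have "map_poly \<phi> h \<noteq> 0"
      using \<open>degree (map_poly \<phi> h) > 0\<close> by auto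
    then have "u \<noteq> 0" "v \<noteq> 0" using uv by auto
    then show ?thesis using deg_h uv by (simp add: degree_mult_eq)
  qed
  moreover have "degree (?ev0 A) \<le> degree u" "degree (?ev0 B) \<le> degree v"
    using low_degree[OF A(1) Du(3,2)] low_degree[OF B(1) Dv(3,2)] by auto
  ultimately show "degree u = 0 \<or> degree v = 0" by linarith
qed assumption

section \<open>Specialization over a Hilbertian field\<close>

lemma hilbertianD:
  assumes "hilbertian TYPE('k::field)" "n \<ge> 1"
    and "irreducible_over (ratfun_in {..<n}) h" "separable_poly h"
    and "f \<in> poly_ring_in {..<n}" "(f :: (nat, 'k) mpoly) \<noteq> 0"
  obtains a g where "mpoly_eval (\<lambda>c. c) a f \<noteq> 0" "specializes_to n a h g" "Factorial_Ring.irreducible g"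
  using assms unfolding hilbertian_def by blast

text \<open>
  Hilbert's theorem for the polynomial \<open>T\<close>, which is irreducible at every point: only the
  condition that \<open>D\<close> does not vanish is left.
\<close>

lemma hilbertian_nonvanishing:
  assumes H: "hilbertian TYPE('k::field)" "n \<ge> 1"
    and D: "D \<in> poly_ring_in {..<n}" "(D :: (nat, 'k) mpoly) \<noteq> 0"
  shows "\<exists>c. mpoly_eval (\<lambda>x. x) c D \<noteq> 0"
proof -
  let ?F = "ratfun_in {..<n} :: (nat, 'k) mpoly fract set"
  interpret F: subring_set ?F by (rule ratfun_in_subfield)
  have "irreducible_over ?F [:0, 1:]"
  proof (rule irreducible_overI[OF ratfun_in_subfield])
    show "[:0, 1:] \<in> polys_over ?F"
      unfolding polys_over_def by (intro F.linear_mem_polys F.zero_mem F.one_mem)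
    fix u v :: "(nat, 'k) mpoly fract poly"
    assume uv: "[:0, 1:] = u * v"
    then have "u \<noteq> 0" "v \<noteq> 0" by auto
    then have "degree u + degree v = degree [:0, 1 :: (nat, 'k) mpoly fract:]"
      unfolding uv by (rule degree_mult_eq[symmetric])
    then have "degree u + degree v = 1" by simp
    then show "degree u = 0 \<or> degree v = 0" by linarith
  qed auto
  moreover have "separable_poly ([:0, 1:] :: (nat, 'k) mpoly fract poly)"
  proof -
    have "map_poly to_ac ([:0, 1:] :: (nat, 'k) mpoly fract poly) = root_poly {0}"
      by (simp add: map_poly_pCons root_poly_def)
    then show ?thesis by (simp add: separable_poly_def rsquarefree_root_poly)
  qed
  ultimately show ?thesis by (rule hilbertianD[OF H _ _ D]) blast
qed

theorem theorem1p2: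
  fixes G :: "('g, 'b) monoid_scheme"
  assumes "group G" and "finite (carrier G)"
    and "infinite (UNIV :: 'k::field set)"
    and "hilbertian TYPE('k)"
    and "retract_rational (ratfun_Const :: 'k \<Rightarrow> ('g, 'k) mpoly fract) (noether_field G)"
  shows "\<exists>K :: 'k alg_closure set.
           galois_extension (range to_ac) K \<and> galois_group (range to_ac) K \<cong> G"
proof -
  interpret R: regular_orbit G "ratfun_in (carrier G) :: ('g, 'k) mpoly fract set" "ratfun_act G" ratfun_Var
    by (rule regular_orbit_ratfun[OF assms(1,2)])
  let ?L = "noether_field G :: ('g, 'k) mpoly fract set"
  have fixed: "R.fixed = ?L" by (rule fixed_ratfun_act[OF assms(1,2)])
  note L_inverse = R.inverse_mem_fixed[unfolded fixed]
  interpret L: subring_set ?L by (rule R.subring_set_fixed[unfolded fixed])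
  define h where "h = R.orbit_poly"
  have h_irred: "irreducible_over ?L h" "lead_coeff h = 1"
    using R.orbit_poly_irreducible R.orbit_poly_simps(1) by (simp_all add: h_def fixed)
  have h_L: "coeff h i \<in> ?L" for i
    using h_irred(1) by (auto simp: irreducible_over_def polys_over_def)
  obtain m :: nat and \<phi> b where \<phi>: "partial_hom ?L \<phi>" and b: "range b \<subseteq> ?L"
    and Const_L: "range (ratfun_Const :: 'k \<Rightarrow> _) \<subseteq> ?L"
    and ret: "\<forall>y\<in>?L. \<exists>P Q. P \<in> poly_ring_in {..<m} \<and> Q \<in> poly_ring_in {..<m} \<and>
      mpoly_eval ratfun_Const b Q \<noteq> 0 \<and> \<phi> y = Fract P Q \<and>
      y = mpoly_eval ratfun_Const b P / mpoly_eval ratfun_Const b Q"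
    using retract_rational_section[OF unital_ring_hom_ratfun_Const assms(5)]
    by (elim exE conjE) (rule that)
  interpret phi: partial_hom ?L \<phi> by fact
  \<comment> \<open>Hilbert's theorem speaks of at least one variable, so one more variable is adjoined.\<close>
  define n where "n = Suc m"
  have n: "n \<ge> 1" by (simp add: n_def)
  let ?V = "{..<n}"
  interpret V: subring_set "poly_ring_in ?V :: (nat, 'k) mpoly set" by (rule subring_set_poly_ring_in)
  have sect: "\<exists>P Q. P \<in> poly_ring_in ?V \<and> Q \<in> poly_ring_in ?V \<and>
      mpoly_eval ratfun_Const b Q \<noteq> 0 \<and> \<phi> y = Fract P Q \<and>
      y = mpoly_eval ratfun_Const b P / mpoly_eval ratfun_Const b Q" if "y \<in> ?L" for y
  proof -
    have "poly_ring_in {..<m} \<subseteq> (poly_ring_in ?V :: (nat, 'k) mpoly set)"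
      by (rule poly_ring_in_mono) (auto simp: n_def)
    with bspec[OF ret that] show ?thesis
      by (elim exE conjE) (intro exI conjI; (rule subsetD)?; assumption)
  qed
  define H where "H = map_poly \<phi> h"
  have H_irred: "irreducible_over (ratfun_in ?V) H"
    unfolding H_def
    by (rule irreducible_over_ratfun[OF unital_ring_hom_ratfun_Const Const_L b L_inverse \<phi> sect
          hilbertian_nonvanishing[OF assms(4) n] h_irred])
  have root: "\<exists>z. poly (map_poly to_ac p) z = 0" if "degree p > 0" for p :: "'f::field poly"
  proof (rule alg_closed_imp_poly_has_root)
    show "degree (map_poly to_ac p) > 0"
      using that by (subst degree_map_poly) (auto dest: injD[OF inj_to_ac, of _ 0])
  qed
  have comp: "map_poly (\<lambda>y. to_ac (\<chi> y)) p = map_poly to_ac (map_poly \<chi> p)" if "\<chi> 0 = 0"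
    for p :: "('g, 'k) mpoly fract poly" and \<chi> :: "_ \<Rightarrow> 'f::field"
    using that by (intro poly_eqI) (simp add: coeff_map_poly)
  have H_degree: "degree H > 0"
    by (rule degree_irreducible_over[OF H_irred ratfun_in_subfield])
  \<comment> \<open>Separability is a case of the labelling of roots: \<open>\<phi>\<close> is itself a specialization of \<open>h\<close>.\<close>
  have "separable_poly H"
  proof -
    let ?\<chi> = "\<lambda>y. to_ac (\<phi> y)"
    obtain z where z: "poly (map_poly ?\<chi> h) z = 0"
      using root[OF H_degree] by (auto simp: H_def comp phi.hom_zero)
    have \<chi>: "partial_hom ?L ?\<chi>" by (rule partial_hom_comp[OF \<phi> partial_hom_to_ac]) simp
    obtain E where E: "E \<subseteq> ?L"
      and spec: "\<forall>B (\<chi> :: _ \<Rightarrow> (nat, 'k) mpoly fract alg_closure) z.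
         partial_hom B \<chi> \<and> E \<subseteq> B \<and> B \<subseteq> ?L \<and> poly (map_poly \<chi> h) z = 0 \<longrightarrow>
        (\<exists>r. inj_on r (carrier G) \<and> map_poly \<chi> h = root_poly (r ` carrier G) \<and>
           (\<forall>g\<in>carrier G. \<exists>P\<in>polys_over B. \<forall>h\<in>carrier G. poly (map_poly \<chi> P) (r h) = r (h \<otimes>\<^bsub>G\<^esub> g)))"
      using R.orbit_specialization unfolding fixed h_def[symmetric] by (elim exE conjE) (rule that)
    obtain r where "map_poly ?\<chi> h = root_poly (r ` carrier G)"
      using spec[rule_format, of ?L ?\<chi> z] E \<chi> z by blast
    then show ?thesis
      using assms(2) by (simp add: separable_poly_def H_def rsquarefree_root_poly comp phi.hom_zero)
  qed
  obtain E where E: "finite E" "E \<subseteq> ?L"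
    and spec: "\<forall>B (\<chi> :: _ \<Rightarrow> 'k alg_closure) z.
       partial_hom B \<chi> \<and> E \<subseteq> B \<and> B \<subseteq> ?L \<and> poly (map_poly \<chi> h) z = 0 \<longrightarrow>
      (\<exists>r. inj_on r (carrier G) \<and> map_poly \<chi> h = root_poly (r ` carrier G) \<and>
         (\<forall>g\<in>carrier G. \<exists>P\<in>polys_over B. \<forall>h\<in>carrier G. poly (map_poly \<chi> P) (r h) = r (h \<otimes>\<^bsub>G\<^esub> g)))"
    using R.orbit_specialization unfolding fixed h_def[symmetric] by (elim exE conjE) (rule that)
  have "\<exists>Q P. Q \<in> poly_ring_in ?V \<and> Q \<noteq> 0 \<and> P \<in> poly_ring_in ?V \<and> \<phi> e = Fract P Q" if "e \<in> E" for e
  proof -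
    have "e \<in> ?L" using E(2) \<open>e \<in> E\<close> by blast
    then obtain P Q where "P \<in> poly_ring_in ?V" "Q \<in> poly_ring_in ?V"
      "mpoly_eval ratfun_Const b Q \<noteq> 0" "\<phi> e = Fract P Q"
      using sect by blast
    moreover from this have "Q \<noteq> 0"
      using unital_ring_hom.hom_0[OF mpoly_eval_hom[OF unital_ring_hom_ratfun_Const]] by auto
    ultimately show ?thesis by blast
  qed
  then have "\<forall>e\<in>E. \<exists>Q. Q \<in> poly_ring_in ?V \<and> Q \<noteq> 0 \<and> (\<exists>P. P \<in> poly_ring_in ?V \<and> \<phi> e = Fract P Q)"
    by blast
  from bchoice[OF this] obtain den where den: "\<And>e. e \<in> E \<Longrightarrow> den e \<in> poly_ring_in ?V \<and> den e \<noteq> 0 \<and>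
      (\<exists>P. P \<in> poly_ring_in ?V \<and> \<phi> e = Fract P (den e))"
    by blast
  \<comment> \<open>Where \<open>f\<close> does not vanish, \<open>\<phi> e\<close> is defined for all \<open>e \<in> E\<close>.\<close>
  define f where "f = (\<Prod>e\<in>E. den e)"
  have f: "f \<in> poly_ring_in ?V" "f \<noteq> 0"
    using den E(1) by (auto simp: f_def intro!: V.prod_mem)
  obtain a q where a: "mpoly_eval (\<lambda>c. c) a f \<noteq> 0" and q: "specializes_to n a H q"
    and q_irred: "Factorial_Ring.irreducible q"
    by (rule hilbertianD[OF assms(4) n H_irred \<open>separable_poly H\<close> f])
  let ?e = "mpoly_eval (\<lambda>c. c) a :: (nat, 'k) mpoly \<Rightarrow> 'k"
  let ?O = "{Fract p q | p q. p \<in> poly_ring_in ?V \<and> q \<in> poly_ring_in ?V \<and> ?e q \<noteq> 0}"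
  have id: "unital_ring_hom (\<lambda>c :: 'k. c)" by standard simp_all
  obtain ev where ev: "partial_hom ?O ev"
    "\<forall>p\<in>poly_ring_in ?V. \<forall>q\<in>poly_ring_in ?V. ?e q \<noteq> 0 \<longrightarrow> ev (Fract p q) = ?e p / ?e q"
    using ratfun_evaluation[OF id, of ?V a] by (elim exE conjE) (rule that)
  interpret ev: partial_hom ?O ev by fact
  define B where "B = {y \<in> ?L. \<phi> y \<in> ?O}"
  have B: "subring_set B"
  proof
    have B_iff: "y \<in> B \<longleftrightarrow> y \<in> ?L \<and> \<phi> y \<in> ?O" for y by (simp only: B_def mem_Collect_eq[of y])
    show "1 \<in> B" unfolding B_iff phi.hom_one by (rule conjI[OF L.one_mem ev.one_mem])
    fix x y assume "x \<in> B" "y \<in> B"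
    then have xy: "x \<in> ?L" "\<phi> x \<in> ?O" "y \<in> ?L" "\<phi> y \<in> ?O" by (simp_all only: B_iff)
    show "x - y \<in> B"
      unfolding B_iff phi.hom_diff[OF xy(1,3)]
      by (rule conjI[OF L.diff_mem[OF xy(1,3)] ev.diff_mem[OF xy(2,4)]])
    show "x * y \<in> B"
      unfolding B_iff phi.hom_mult[OF xy(1,3)]
      by (rule conjI[OF L.mult_mem[OF xy(1,3)] ev.mult_mem[OF xy(2,4)]])
  qed
  have B_L: "B \<subseteq> ?L" by (auto simp: B_def)
  define \<chi> where "\<chi> y = ev (\<phi> y)" for y
  have \<chi>: "partial_hom B \<chi>"
    unfolding \<chi>_def
    by (rule partial_hom_comp[OF partial_hom_subset[OF \<phi> B B_L] ev(1)]) (simp add: B_def)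
  interpret chi: partial_hom B \<chi> by (rule \<chi>)
  have h_q: "map_poly \<chi> h = q"
  proof (rule poly_eqI)
    fix i
    obtain p s where ps: "p \<in> poly_ring_in ?V" "s \<in> poly_ring_in ?V" "?e s \<noteq> 0"
      "coeff H i = Fract p s" "coeff q i = ?e p / ?e s"
      using q unfolding specializes_to_def by blast
    have "coeff (map_poly \<chi> h) i = ev (coeff H i)"
      by (simp add: coeff_map_poly chi.hom_zero H_def phi.hom_zero flip: \<chi>_def)
    then show "coeff (map_poly \<chi> h) i = coeff q i" using ps ev(2) by simp
  qed
  have E_B: "E \<subseteq> B"
  proof
    fix e assume e: "e \<in> E"
    obtain P where P: "P \<in> poly_ring_in ?V" "\<phi> e = Fract P (den e)" using den[OF e] by blast
    have "?e f = (\<Prod>e\<in>E. ?e (den e))"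
      unfolding f_def by (rule unital_ring_hom_prod[OF mpoly_eval_hom[OF id]])
    then have "?e (den e) \<noteq> 0" using a e E(1) by auto
    then have "\<phi> e \<in> ?O" using P den[OF e] by blast
    then show "e \<in> B" using e E(2) by (auto simp: B_def)
  qed
  let ?\<chi> = "\<lambda>y. to_ac (\<chi> y)"
  have "degree q > 0"
    using q_irred by (intro degree_irreducible_over[of UNIV]) (simp_all add: irreducible_over_UNIV subring_set_def)
  then obtain z where z: "poly (map_poly ?\<chi> h) z = 0"
    using root[of q] by (auto simp: comp chi.hom_zero h_q)
  have "partial_hom B ?\<chi>" by (rule partial_hom_comp[OF \<chi> partial_hom_to_ac]) simp
  with E_B B_L z spec[rule_format, of B ?\<chi> z]
  obtain r where r: "inj_on r (carrier G)" "map_poly ?\<chi> h = root_poly (r ` carrier G)"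
    "\<forall>g\<in>carrier G. \<exists>P\<in>polys_over B. \<forall>h\<in>carrier G. poly (map_poly ?\<chi> P) (r h) = r (h \<otimes>\<^bsub>G\<^esub> g)"
    by blast
  interpret labelled_roots G q r
  proof (intro labelled_roots.intro labelled_roots_axioms.intro assms(1,2) q_irred r(1))
    show "map_poly to_ac q = root_poly (r ` carrier G)"
      using r(2) by (simp add: comp chi.hom_zero h_q)
    fix g assume "g \<in> carrier G"
    then obtain P where "\<forall>h\<in>carrier G. poly (map_poly ?\<chi> P) (r h) = r (h \<otimes>\<^bsub>G\<^esub> g)"
      using r(3) by blast
    then show "\<exists>P. \<forall>h\<in>carrier G. poly (map_poly to_ac P) (r h) = r (h \<otimes>\<^bsub>G\<^esub> g)"
      by (intro exI[of _ "map_poly \<chi> P"]) (simp add: comp chi.hom_zero)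
  qed
  show ?thesis using galois_extension_K galois_group_K by blast
qed

end
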